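(* Let $G$ be a compact Hausdorff Abelian group with normalized Haar measure $\mu$, let $G^\wedge$ be its dual group with counting measure $\nu$, let $p$ be a continuous invariant pseudo-metric on $G^\wedge$, and let $\gamma(\xi):=p(\xi,1)$ for $\xi\in G^\wedge$. Then the Sobolev space $H^1_\gamma(G)$ is compactly embedded in $L^2(G)$ if and only if the operator $T:L^2(G^\wedge)\to L^2(G^\wedge)$ defined by $$[T(f)](\xi):=\frac{f(\xi)}{\sqrt{1+\gamma(\xi)^2}},\qquad \xi\in G^\wedge,$$ is compact.
   Context: $G^\wedge$ is the group of continuous homomorphisms $\xi:G\to\mathbb{S}^1$ with identity element $1$ (discrete since $G$ is compact). A pseudo-metric $p$ on $G^\wedge$ is invariant if it is invariant under translations of the group. The Fourier transform is $\widehat{h}(\xi)=\int_G h(x)\overline{\xi(x)}\,d\mu(x)$. $H^1_\gamma(G)$ is the set of $h\in L^2(G;\mu)$ with $\|h\|_{H^1_\gamma(G)}^2:=\int_{G^\wedge}(1+\gamma(\xi)^2)|\widehat{h}(\xi)|^2\,d\nu(\xi)<\infty$, equipped with this norm. Compactly embedded means that every sequence bounded in $H^1_\gamma(G)$ has a subsequence converging in $L^2(G)$. *)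

theory Defs
  imports "HOL-Analysis.Analysis"
begin

text \<open>The ambient group is written additively and is the whole of a type of class
  \<open>topological_ab_group_add\<close>; its dual is written multiplicatively.
  Haar measures are Borel, translation invariant and regular; on a group that is not second
  countable, regularity is not automatic for finite Borel measures.\<close>

definition normalized_haar_measure :: "'a::topological_ab_group_add measure \<Rightarrow> bool" where
  "normalized_haar_measure \<mu> \<longleftrightarrow>
     sets \<mu> = sets borel \<and>
     emeasure \<mu> UNIV = 1 \<and>
     (\<forall>a. \<forall>A\<in>sets borel. emeasure \<mu> ((+) a ` A) = emeasure \<mu> A) \<and>
     (\<forall>A\<in>sets borel. emeasure \<mu> A = (INF U\<in>{U. open U \<and> A \<subseteq> U}. emeasure \<mu> U)) \<and>
     (\<forall>U. open U \<longrightarrow> emeasure \<mu> U = (SUP K\<in>{K. compact K \<and> K \<subseteq> U}. emeasure \<mu> K))"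

definition dual_group :: "('a::topological_ab_group_add \<Rightarrow> complex) set" where
  "dual_group = {\<xi>. continuous_on UNIV \<xi> \<and> range \<xi> \<subseteq> sphere 0 1 \<and> (\<forall>x y. \<xi> (x + y) = \<xi> x * \<xi> y)}"

text \<open>The compact-open topology; it is discrete when the group is compact.\<close>

definition dual_topology :: "('a::topological_ab_group_add \<Rightarrow> complex) topology" where
  "dual_topology =
     topology_generated_by {{\<xi>\<in>dual_group. \<xi> ` K \<subseteq> U} | K U. compact K \<and> open U}"

definition pseudo_metric_on :: "'b set \<Rightarrow> ('b \<Rightarrow> 'b \<Rightarrow> real) \<Rightarrow> bool" where
  "pseudo_metric_on S p \<longleftrightarrow>
     (\<forall>x\<in>S. p x x = 0) \<and>
     (\<forall>x\<in>S. \<forall>y\<in>S. 0 \<le> p x y \<and> p x y = p y x) \<and>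
     (\<forall>x\<in>S. \<forall>y\<in>S. \<forall>z\<in>S. p x z \<le> p x y + p y z)"

definition continuous_invariant_pseudo_metric ::
  "(('a::topological_ab_group_add \<Rightarrow> complex) \<Rightarrow> ('a \<Rightarrow> complex) \<Rightarrow> real) \<Rightarrow> bool" where
  "continuous_invariant_pseudo_metric p \<longleftrightarrow>
     pseudo_metric_on dual_group p \<and>
     continuous_map (prod_topology dual_topology dual_topology) euclideanreal (\<lambda>(\<xi>, \<eta>). p \<xi> \<eta>) \<and>
     (\<forall>\<xi>\<in>dual_group. \<forall>\<eta>\<in>dual_group. \<forall>\<zeta>\<in>dual_group.
        p (\<lambda>x. \<zeta> x * \<xi> x) (\<lambda>x. \<zeta> x * \<eta> x) = p \<xi> \<eta>)"

text \<open>Elements of \<open>L\<^sup>2\<close> are given by representatives: functions are not identified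
  when they agree almost everywhere, so \<open>L2_norm\<close> is a seminorm.\<close>

definition L2 :: "'b measure \<Rightarrow> ('b \<Rightarrow> complex) set" where
  "L2 M = {f \<in> borel_measurable M. integrable M (\<lambda>x. (cmod (f x))\<^sup>2)}"

definition L2_norm :: "'b measure \<Rightarrow> ('b \<Rightarrow> complex) \<Rightarrow> real" where
  "L2_norm M f = sqrt (\<integral>x. (cmod (f x))\<^sup>2 \<partial>M)"

definition L2_convergent_subsequence :: "'b measure \<Rightarrow> (nat \<Rightarrow> 'b \<Rightarrow> complex) \<Rightarrow> bool" where
  "L2_convergent_subsequence M u \<longleftrightarrow>
     (\<exists>r l. strict_mono r \<and> l \<in> L2 M \<and> (\<lambda>n. L2_norm M (\<lambda>x. u (r n) x - l x)) \<longlonglongrightarrow> 0)"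

text \<open>Linearity and boundedness on representatives make such an operator respect
  equality almost everywhere.\<close>

definition L2_compact_operator :: "'b measure \<Rightarrow> (('b \<Rightarrow> complex) \<Rightarrow> ('b \<Rightarrow> complex)) \<Rightarrow> bool" where
  "L2_compact_operator M T \<longleftrightarrow>
     (\<forall>f\<in>L2 M. T f \<in> L2 M) \<and>
     (\<forall>f\<in>L2 M. \<forall>g\<in>L2 M. AE x in M. T (\<lambda>x. f x + g x) x = T f x + T g x) \<and>
     (\<forall>f\<in>L2 M. \<forall>c. AE x in M. T (\<lambda>x. c * f x) x = c * T f x) \<and>
     (\<forall>u. (\<forall>n. u n \<in> L2 M) \<and> (\<exists>B. \<forall>n. L2_norm M (u n) \<le> B) \<longrightarrow>
        L2_convergent_subsequence M (\<lambda>n. T (u n)))"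

definition fourier_transform ::
  "'a measure \<Rightarrow> ('a \<Rightarrow> complex) \<Rightarrow> ('a \<Rightarrow> complex) \<Rightarrow> complex" where
  "fourier_transform \<mu> h \<xi> = (\<integral>x. h x * cnj (\<xi> x) \<partial>\<mu>)"

definition sobolev_H1 :: "'a::topological_ab_group_add measure \<Rightarrow> (('a \<Rightarrow> complex) \<Rightarrow> real) \<Rightarrow>
    ('a \<Rightarrow> complex) set" where
  "sobolev_H1 \<mu> \<gamma> = {h \<in> L2 \<mu>. integrable (count_space dual_group)
     (\<lambda>\<xi>. (1 + (\<gamma> \<xi>)\<^sup>2) * (cmod (fourier_transform \<mu> h \<xi>))\<^sup>2)}"

definition sobolev_norm :: "'a::topological_ab_group_add measure \<Rightarrow> (('a \<Rightarrow> complex) \<Rightarrow> real) \<Rightarrow>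
    ('a \<Rightarrow> complex) \<Rightarrow> real" where
  "sobolev_norm \<mu> \<gamma> h = sqrt (\<integral>\<xi>. (1 + (\<gamma> \<xi>)\<^sup>2) * (cmod (fourier_transform \<mu> h \<xi>))\<^sup>2
     \<partial>count_space dual_group)"

definition sobolev_compactly_embedded ::
  "'a::topological_ab_group_add measure \<Rightarrow> (('a \<Rightarrow> complex) \<Rightarrow> real) \<Rightarrow> bool" where
  "sobolev_compactly_embedded \<mu> \<gamma> \<longleftrightarrow>
     (\<forall>u. (\<forall>n. u n \<in> sobolev_H1 \<mu> \<gamma>) \<and> (\<exists>B. \<forall>n. sobolev_norm \<mu> \<gamma> (u n) \<le> B) \<longrightarrow>
        L2_convergent_subsequence \<mu> u)"

end

theory Submission
  imports Defs "HOL-Library.Diagonal_Subsequence"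
begin

text \<open>
  Both compactness statements say the same thing about \<open>\<gamma>\<close>: every sublevel set
  \<open>{\<xi> \<in> dual_group. 1 + \<gamma>(\<xi>)\<^sup>2 \<le> R}\<close> is finite.

  For the operator this is elementary (\<open>diagonal_operator_compact_iff\<close>). Multiplication by
  \<open>1 / sqrt (1 + \<gamma>\<^sup>2)\<close> moves the unit vectors of an infinite sublevel set to points that stay a fixed
  distance apart; if all sublevel sets are finite, then the part of \<open>T f\<close> outside a large one is
  uniformly small and the rest lives on finitely many coordinates. For the embedding, the characters
  in an infinite sublevel set form an orthonormal sequence that is bounded in the Sobolev norm, so
  compactness forces finiteness. For the converse the argument with small tails works on the Fourier
  side, and to carry it back to \<open>L\<^sup>2(G)\<close> one needs that the Fourier coefficients control the \<open>L\<^sup>2\<close> norm.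
  That is completeness of the characters (\<open>Parseval_approximation\<close>), and most of the text proves it.

  The core is \<open>exists_nonzero_fourier_coefficient\<close>: a nonzero continuous \<open>g\<close> has a nonzero
  coefficient at some character. It is obtained from an extremal problem. For continuous \<open>w\<close> let
  \<open>\<psi>\<^sub>w\<close> be the autocorrelation of the convolution \<open>g * w\<close>. On the functions \<open>w\<close> of norm at most 1 the
  convolutions \<open>g * w\<close> are uniformly bounded and equicontinuous, so the supremum \<open>s\<close> of the \<open>L\<^sup>2\<close> norms
  of the \<open>\<psi>\<^sub>w\<close> is attained by the autocorrelation \<open>\<psi>\<close> of a uniform limit \<open>u\<close> of such convolutions.
  Replace \<open>w\<close> by \<open>w + c \<cdot> w(\<sqdot> + a)\<close> and by \<open>w - c \<cdot> w(\<sqdot> + a)\<close> with \<open>\<bar>c\<bar> = 1\<close>. By the parallelogram law the squared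
  norms of these two functions add up to at most 4, while the two autocorrelations that arise from
  \<open>u\<close> add up to \<open>4 \<psi>\<close>, of norm \<open>4 s\<close>. So the triangle inequality between them is an equality and both
  are multiples of \<open>\<psi>\<close>. The choices \<open>c = 1\<close> and \<open>c = \<i>\<close> show that every translate of \<open>\<psi>\<close> is a multiple of
  \<open>\<psi>\<close>. Hence \<open>\<psi> / \<psi>(0)\<close> is a character, \<open>u\<close> is a multiple of it, and \<open>g\<close> cannot be orthogonal to it,
  because then \<open>u\<close> would be, too. For this last step Fubini's theorem would
  be delicate, since the Borel sets of \<open>G \<times> G\<close> can form a larger algebra than the product of the Borel
  algebras; the one interchange of integrals is replaced by an approximation of \<open>g * w\<close> by finite
  combinations of translates of \<open>g\<close>.

  Applied to \<open>f(\<sqdot> - a) - f\<close> with a Urysohn function \<open>f\<close> the core shows that characters separate points.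
  Then Stone-Weierstrass makes the trigonometric polynomials uniformly dense, regularity of the Haar
  measure makes them dense in \<open>L\<^sup>2\<close>, and the best approximation property of Fourier sums gives
  the form of Parseval's identity that is used.
\<close>

section \<open>Square-integrable functions\<close>

definition L2_inner :: "'b measure \<Rightarrow> ('b \<Rightarrow> complex) \<Rightarrow> ('b \<Rightarrow> complex) \<Rightarrow> complex" where
  "L2_inner M f g = (\<integral>x. f x * cnj (g x) \<partial>M)"

lemma L2_measurable: "f \<in> L2 M \<Longrightarrow> f \<in> borel_measurable M"
  by (simp add: L2_def)

lemma L2_integrable: "f \<in> L2 M \<Longrightarrow> integrable M (\<lambda>x. (cmod (f x))\<^sup>2)"
  by (simp add: L2_def)

lemma cmod_add_square_le: "(cmod (a + b))\<^sup>2 \<le> 2 * (cmod a)\<^sup>2 + 2 * (cmod b)\<^sup>2"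
proof -
  have "(cmod (a + b))\<^sup>2 \<le> (cmod a + cmod b)\<^sup>2"
    by (simp add: norm_triangle_ineq power_mono)
  also have "\<dots> \<le> 2 * (cmod a)\<^sup>2 + 2 * (cmod b)\<^sup>2"
    by (smt (verit) power2_sum sum_squares_bound)
  finally show ?thesis .
qed

lemma cmod_diff_square_le: "(cmod (a - b))\<^sup>2 \<le> 2 * (cmod a)\<^sup>2 + 2 * (cmod b)\<^sup>2"
  using cmod_add_square_le[of a "- b"] by simp

lemma L2_add: assumes "f \<in> L2 M" "g \<in> L2 M" shows "(\<lambda>x. f x + g x) \<in> L2 M"
proof -
  have [measurable]: "f \<in> borel_measurable M" "g \<in> borel_measurable M"
    using assms by (auto simp: L2_def)
  have "integrable M (\<lambda>x. 2 * (cmod (f x))\<^sup>2 + 2 * (cmod (g x))\<^sup>2)"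
    using assms by (auto simp: L2_def)
  then have "integrable M (\<lambda>x. (cmod (f x + g x))\<^sup>2)"
    by (rule Bochner_Integration.integrable_bound)
      (use cmod_add_square_le in \<open>auto simp: abs_of_nonneg\<close>)
  then show ?thesis by (auto simp: L2_def)
qed

lemma L2_scale: assumes "f \<in> L2 M" shows "(\<lambda>x. c * f x) \<in> L2 M"
  using assms by (auto simp: L2_def norm_mult power_mult_distrib)

lemma L2_diff: assumes "f \<in> L2 M" "g \<in> L2 M" shows "(\<lambda>x. f x - g x) \<in> L2 M"
  using L2_add[OF assms(1) L2_scale[OF assms(2), of "-1"]] by simp

lemma L2_zero: "(\<lambda>_. 0) \<in> L2 M"
  by (simp add: L2_def)

lemma L2_sum: "(\<And>i. i \<in> F \<Longrightarrow> f i \<in> L2 M) \<Longrightarrow> (\<lambda>x. \<Sum>i\<in>F. f i x) \<in> L2 M"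
  by (induction F rule: infinite_finite_induct) (auto intro: L2_zero L2_add)

lemma L2_inner_integrable:
  assumes "f \<in> L2 M" "g \<in> L2 M" shows "integrable M (\<lambda>x. f x * cnj (g x))"
proof -
  have [measurable]: "f \<in> borel_measurable M" "g \<in> borel_measurable M"
    using assms by (auto simp: L2_def)
  have "integrable M (\<lambda>x. (cmod (f x))\<^sup>2 + (cmod (g x))\<^sup>2)"
    using assms by (auto simp: L2_def)
  then show ?thesis
  proof (rule Bochner_Integration.integrable_bound)
    have "cmod (f x * cnj (g x)) \<le> (cmod (f x))\<^sup>2 + (cmod (g x))\<^sup>2" for x
      using sum_squares_bound[of "cmod (f x)" "cmod (g x)"]
        mult_nonneg_nonneg[of "cmod (f x)" "cmod (g x)"] 
      by (auto simp: norm_mult simp del: mult_nonneg_nonneg)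
    then show "AE x in M. cmod (f x * cnj (g x)) \<le> norm ((cmod (f x))\<^sup>2 + (cmod (g x))\<^sup>2)"
      by (auto simp: abs_of_nonneg)
    have "(\<lambda>x. cnj (g x)) \<in> borel_measurable M"
      by (rule borel_measurable_continuous_on[of cnj]) (auto intro: continuous_intros)
    then show "(\<lambda>x. f x * cnj (g x)) \<in> borel_measurable M"
      by measurable
  qed
qed

lemma L2_norm_nonneg [simp]: "L2_norm M f \<ge> 0"
  by (simp add: L2_norm_def)

lemma L2_norm_square: "(L2_norm M f)\<^sup>2 = (\<integral>x. (cmod (f x))\<^sup>2 \<partial>M)"
  by (simp add: L2_norm_def)

lemma L2_norm_le_iff: "b \<ge> 0 \<Longrightarrow> L2_norm M f \<le> b \<longleftrightarrow> (\<integral>x. (cmod (f x))\<^sup>2 \<partial>M) \<le> b\<^sup>2"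
  unfolding L2_norm_square[symmetric] by (metis L2_norm_nonneg abs_le_square_iff abs_of_nonneg)

lemma L2_inner_add_left:
  assumes "f \<in> L2 M" "g \<in> L2 M" "h \<in> L2 M"
  shows "L2_inner M (\<lambda>x. f x + g x) h = L2_inner M f h + L2_inner M g h"
  unfolding L2_inner_def using assms
  by (simp add: distrib_right L2_inner_integrable Bochner_Integration.integral_add)

lemma L2_inner_sum_left:
  assumes "\<And>i. i \<in> F \<Longrightarrow> f i \<in> L2 M" "h \<in> L2 M"
  shows "L2_inner M (\<lambda>x. \<Sum>i\<in>F. f i x) h = (\<Sum>i\<in>F. L2_inner M (f i) h)"
  unfolding L2_inner_def using assms
  by (simp add: sum_distrib_right L2_inner_integrable Bochner_Integration.integral_sum)

lemma L2_inner_scale_left: "L2_inner M (\<lambda>x. c * f x) h = c * L2_inner M f h"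
  unfolding L2_inner_def by (simp add: mult.assoc)

lemma L2_inner_commute: "L2_inner M f g = cnj (L2_inner M g f)"
  unfolding L2_inner_def by (simp add: Bochner_Integration.integral_cnj[symmetric] mult.commute
     del: integral_cnj Bochner_Integration.integral_cnj)

lemma L2_norm_scale: "L2_norm M (\<lambda>x. c * f x) = cmod c * L2_norm M f"
  by (simp add: L2_norm_def norm_mult power_mult_distrib real_sqrt_mult)

lemma L2_norm_minus_commute: "L2_norm M (\<lambda>x. f x - g x) = L2_norm M (\<lambda>x. g x - f x)"
  by (simp add: L2_norm_def norm_minus_commute)

lemma L2_norm_add_square:
  assumes "f \<in> L2 M" "g \<in> L2 M"
  shows "(L2_norm M (\<lambda>x. f x + g x))\<^sup>2 = (L2_norm M f)\<^sup>2 + 2 * Re (L2_inner M f g) + (L2_norm M g)\<^sup>2"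
proof -
  have eq: "(cmod (f x + g x))\<^sup>2 = (cmod (f x))\<^sup>2 + 2 * Re (f x * cnj (g x)) + (cmod (g x))\<^sup>2" for x
    unfolding cmod_power2 by (simp add: power2_eq_square algebra_simps)
  have "integrable M (\<lambda>x. Re (f x * cnj (g x)))"
    using L2_inner_integrable[OF assms] by (rule integrable_Re)
  then show ?thesis
    unfolding L2_norm_square eq L2_inner_def
    using assms L2_inner_integrable[OF assms]
    by (simp add: L2_integrable integral_Re[symmetric] del: integral_Re times_complex.sel)
qed

lemma L2_norm_diff_square:
  assumes "f \<in> L2 M" "g \<in> L2 M"
  shows "(L2_norm M (\<lambda>x. f x - g x))\<^sup>2 = (L2_norm M f)\<^sup>2 - 2 * Re (L2_inner M f g) + (L2_norm M g)\<^sup>2"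
proof -
  have "(L2_norm M (\<lambda>x. f x + (- 1) * g x))\<^sup>2 =
    (L2_norm M f)\<^sup>2 + 2 * Re (L2_inner M f (\<lambda>x. (- 1) * g x)) + (L2_norm M (\<lambda>x. (- 1) * g x))\<^sup>2"
    by (rule L2_norm_add_square[OF assms(1) L2_scale[OF assms(2)]])
  moreover have "L2_inner M f (\<lambda>x. (- 1) * g x) = - L2_inner M f g"
    by (simp add: L2_inner_def)
  moreover have "L2_norm M (\<lambda>x. (- 1) * g x) = L2_norm M g"
    by (simp add: L2_norm_def)
  ultimately show ?thesis by simp
qed

text \<open>
  The identity behind both the Cauchy-Schwarz inequality and its case of equality: the left-hand side
  is a square, and it vanishes when the inner product is as large as possible.
\<close>

lemma L2_norm_cross_square:
  assumes "f \<in> L2 M" "g \<in> L2 M"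
  defines "a \<equiv> L2_norm M f" and "b \<equiv> L2_norm M g"
  shows "(L2_norm M (\<lambda>x. of_real b * f x - of_real a * g x))\<^sup>2
     = 2 * (a * b) * (a * b - Re (L2_inner M f g))"
proof -
  have "L2_inner M (\<lambda>x. of_real b * f x) (\<lambda>x. of_real a * g x) = of_real (a * b) * L2_inner M f g"
    by (simp add: L2_inner_def mult_ac flip: Bochner_Integration.integral_mult_right_zero)
  then show ?thesis
    using L2_norm_diff_square[OF L2_scale[OF assms(1), of "of_real b"] L2_scale[OF assms(2), of "of_real a"]]
    by (simp add: L2_norm_scale a_def[symmetric] b_def[symmetric] power2_eq_square algebra_simps)
qed

lemma Re_L2_inner_le:
  assumes "f \<in> L2 M" "g \<in> L2 M"
  shows "Re (L2_inner M f g) \<le> L2_norm M f * L2_norm M g"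
proof (cases "L2_norm M f * L2_norm M g = 0")
  case True
  then consider "L2_norm M f = 0" | "L2_norm M g = 0" by auto
  then have "AE x in M. f x = 0 \<or> g x = 0"
  proof cases
    case 1
    then have "AE x in M. (cmod (f x))\<^sup>2 = 0"
      using integral_nonneg_eq_0_iff_AE[OF L2_integrable[OF assms(1)]] L2_norm_square[of M f] by simp
    then show ?thesis by auto
  next
    case 2
    then have "AE x in M. (cmod (g x))\<^sup>2 = 0"
      using integral_nonneg_eq_0_iff_AE[OF L2_integrable[OF assms(2)]] L2_norm_square[of M g] by simp
    then show ?thesis by auto
  qed
  then have "L2_inner M f g = 0"
    unfolding L2_inner_def by (intro integral_eq_zero_AE) auto
  then show ?thesis by (simp add: True)
next
  case False
  then have pos: "L2_norm M f * L2_norm M g > 0"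
    by (simp add: less_le)
  have "0 \<le> 2 * (L2_norm M f * L2_norm M g) * (L2_norm M f * L2_norm M g - Re (L2_inner M f g))"
    unfolding L2_norm_cross_square[OF assms, symmetric] by simp
  with pos show ?thesis by (simp add: zero_le_mult_iff)
qed

lemma L2_norm_triangle:
  assumes "f \<in> L2 M" "g \<in> L2 M"
  shows "L2_norm M (\<lambda>x. f x + g x) \<le> L2_norm M f + L2_norm M g"
proof (rule power2_le_imp_le)
  show "(L2_norm M (\<lambda>x. f x + g x))\<^sup>2 \<le> (L2_norm M f + L2_norm M g)\<^sup>2"
    using Re_L2_inner_le[OF assms] unfolding L2_norm_add_square[OF assms] power2_sum by simp
qed simp

lemma L2_norm_triangle_diff:
  assumes "f \<in> L2 M" "g \<in> L2 M" "h \<in> L2 M"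
  shows "L2_norm M (\<lambda>x. f x - h x) \<le> L2_norm M (\<lambda>x. f x - g x) + L2_norm M (\<lambda>x. g x - h x)"
  using L2_norm_triangle[OF L2_diff[OF assms(1,2)] L2_diff[OF assms(2,3)]] by simp

text \<open>
  In a Hilbert space the triangle inequality is strict unless the vectors are proportional. The conclusion
  expresses proportionality without dividing by a norm that might be 0.
\<close>

lemma L2_norm_triangle_equality:
  assumes "f \<in> L2 M" "g \<in> L2 M" 
    and "L2_norm M f + L2_norm M g \<le> L2_norm M (\<lambda>x. f x + g x)"
  shows "L2_norm M (\<lambda>x. of_real (L2_norm M g) * f x - of_real (L2_norm M f) * g x) = 0"
proof -
  have "(L2_norm M f + L2_norm M g)\<^sup>2 \<le> (L2_norm M (\<lambda>x. f x + g x))\<^sup>2"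
    by (rule power_mono[OF assms(3)]) simp
  then have "L2_norm M f * L2_norm M g \<le> Re (L2_inner M f g)"
    unfolding L2_norm_add_square[OF assms(1,2)] power2_sum by simp
  with Re_L2_inner_le[OF assms(1,2)] have "Re (L2_inner M f g) = L2_norm M f * L2_norm M g" by simp
  then show ?thesis
    using L2_norm_cross_square[OF assms(1,2)] by simp
qed

lemma L2_parallelogram:
  assumes "f \<in> L2 M" "g \<in> L2 M"
  shows "(L2_norm M (\<lambda>x. f x + g x))\<^sup>2 + (L2_norm M (\<lambda>x. f x - g x))\<^sup>2
    = 2 * (L2_norm M f)\<^sup>2 + 2 * (L2_norm M g)\<^sup>2"
  by (simp add: L2_norm_add_square[OF assms] L2_norm_diff_square[OF assms])

section \<open>Completeness and a compactness criterion\<close>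

text \<open>
  The classical argument by a rapidly convergent subsequence. The measure may be infinite (counting measure
  on an infinite set is needed below), so \<open>L\<^sup>2\<close> convergence cannot be reduced to \<open>L\<^sup>1\<close> convergence;
  almost everywhere convergence is forced by the integrability of a weighted sum of squares, and
  Fatou's lemma bounds the distance to the limit.
\<close>

lemma L2_complete:
  assumes u: "\<And>n. u n \<in> L2 M"
    and Cauchy: "\<And>e. e > 0 \<Longrightarrow> \<exists>N. \<forall>m\<ge>N. \<forall>n\<ge>N. L2_norm M (\<lambda>x. u m x - u n x) < e"
  shows "\<exists>l\<in>L2 M. (\<lambda>n. L2_norm M (\<lambda>x. u n x - l x)) \<longlonglongrightarrow> 0"
proof -
  (* The rate 1/4 makes the sum of the squared increments finite even with the weights 2^k that enter below. *)
  have "\<forall>k. \<exists>N. \<forall>m\<ge>N. \<forall>n\<ge>N. L2_norm M (\<lambda>x. u m x - u n x) < (1 / 4) ^ k"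
    using Cauchy by simp
  then obtain N where N: "\<And>k m n. m \<ge> N k \<Longrightarrow> n \<ge> N k \<Longrightarrow> L2_norm M (\<lambda>x. u m x - u n x) < (1 / 4) ^ k"
    by metis
  (* Partial sums turn the thresholds N into a monotone sequence of indices. *)
  define r where "r = (\<lambda>k. \<Sum>j\<le>k. N j)"
  have r_ge: "N k \<le> r k" for k
    unfolding r_def by (rule member_le_sum) auto
  have r_mono: "r j \<le> r k" if "j \<le> k" for j k
    unfolding r_def using that by (intro sum_mono2) auto
  define v where "v = (\<lambda>k. u (r k))"
  have v: "v k \<in> L2 M" for k
    using u by (simp add: v_def)
  have [measurable]: "v k \<in> borel_measurable M" for k
    using v by (rule L2_measurable)
  have v_u: "L2_norm M (\<lambda>x. v k x - u n x) < (1 / 4) ^ k" if "n \<ge> r k" for k n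
    unfolding v_def using that r_ge[of k] by (intro N) auto
  have v_v: "L2_norm M (\<lambda>x. v k x - v m x) < (1 / 4) ^ k" if "k \<le> m" for k m
    using v_u[OF r_mono[OF that]] by (simp add: v_def)
  define d where "d = (\<lambda>k x. v (Suc k) x - v k x)"
  have [measurable]: "d k \<in> borel_measurable M" for k
    unfolding d_def by measurable
  have int_d: "(\<integral>\<^sup>+x. ennreal (2 ^ k * (cmod (d k x))\<^sup>2) \<partial>M) \<le> ennreal ((1 / 8) ^ k)" for k
  proof -
    have i: "integrable M (\<lambda>x. 2 ^ k * (cmod (d k x))\<^sup>2)"
      using L2_integrable[OF L2_diff[OF v[of "Suc k"] v[of k]]] by (simp add: d_def)
    have "(\<integral>x. (cmod (d k x))\<^sup>2 \<partial>M) \<le> ((1 / 4) ^ k)\<^sup>2"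
      using v_v[of k "Suc k"] unfolding d_def
      by (subst L2_norm_le_iff[symmetric]) (auto simp: L2_norm_minus_commute)
    then have "2 ^ k * (\<integral>x. (cmod (d k x))\<^sup>2 \<partial>M) \<le> 2 ^ k * ((1 / 4) ^ k)\<^sup>2"
      by simp
    also have "\<dots> = (1 / 8) ^ k"
      by (simp add: power2_eq_square flip: power_mult_distrib)
    finally have "(\<integral>x. 2 ^ k * (cmod (d k x))\<^sup>2 \<partial>M) \<le> (1 / 8) ^ k" by simp
    then show ?thesis
      using i by (subst nn_integral_eq_integral) (auto intro: ennreal_leI)
  qed
  have "(\<integral>\<^sup>+x. (\<Sum>k. ennreal (2 ^ k * (cmod (d k x))\<^sup>2)) \<partial>M)
      = (\<Sum>k. \<integral>\<^sup>+x. ennreal (2 ^ k * (cmod (d k x))\<^sup>2) \<partial>M)"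
    by (rule nn_integral_suminf) measurable
  also have "\<dots> \<le> (\<Sum>k. ennreal ((1 / 8) ^ k))"
    by (intro suminf_le int_d) auto
  also have "\<dots> = ennreal (\<Sum>k. (1 / 8) ^ k)"
    by (intro suminf_ennreal2) (auto intro: summable_geometric)
  also have "\<dots> < \<infinity>" by simp
  finally have "AE x in M. (\<Sum>k. ennreal (2 ^ k * (cmod (d k x))\<^sup>2)) \<noteq> \<infinity>"
    by (intro nn_integral_PInf_AE) auto
  then have AE_conv: "AE x in M. convergent (\<lambda>k. v k x)"
  proof eventually_elim
    case (elim x)
    then have "summable (\<lambda>k. 2 ^ k * (cmod (d k x))\<^sup>2)"
      by (intro summable_suminf_not_top) auto
    then have s: "summable (\<lambda>k. 2 ^ k * (cmod (d k x))\<^sup>2 + (1 / 2) ^ k)"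
      by (intro summable_add summable_geometric) auto
    have "summable (\<lambda>k. d k x)"
    proof (rule summable_comparison_test[OF _ s], intro exI allI impI)
      fix k
      (* With t^2 = 2^k the product of t |d| and 1/t is |d|, so the weighted square and a geometric
         term together dominate |d|. *)
      define t where "t = (sqrt 2) ^ k"
      have t: "t > 0" "2 ^ k = t\<^sup>2" "(1 / 2) ^ k = (1 / t)\<^sup>2"
        by (auto simp: t_def power2_eq_square power_mult_distrib[symmetric] power_one_over)
      have "2 * (t * cmod (d k x)) * (1 / t) \<le> (t * cmod (d k x))\<^sup>2 + (1 / t)\<^sup>2"
        by (rule sum_squares_bound)
      then have "2 * cmod (d k x) \<le> 2 ^ k * (cmod (d k x))\<^sup>2 + (1 / 2) ^ k"
        using t by (simp add: power_mult_distrib)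
      then show "cmod (d k x) \<le> 2 ^ k * (cmod (d k x))\<^sup>2 + (1 / 2) ^ k"
        using norm_ge_zero[of "d k x"] by linarith
    qed
    then have "convergent (\<lambda>n. (\<Sum>k<n. d k x) + v 0 x)"
      by (intro convergent_add convergent_const) (simp add: summable_iff_convergent)
    then show "convergent (\<lambda>k. v k x)"
      unfolding d_def sum_lessThan_telescope[of "\<lambda>k. v k x"] by simp
  qed
  define l where "l = (\<lambda>x. lim (\<lambda>k. v k x))"
  have [measurable]: "l \<in> borel_measurable M"
    unfolding l_def by measurable
  have AE_lim: "AE x in M. (\<lambda>k. v k x) \<longlonglongrightarrow> l x"
    using AE_conv by eventually_elim (simp add: l_def convergent_LIMSEQ_iff)
  have fatou: "(\<integral>\<^sup>+x. ennreal ((cmod (v k x - l x))\<^sup>2) \<partial>M) \<le> ennreal (((1 / 4) ^ k)\<^sup>2)" for k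
  proof -
    have "(\<integral>\<^sup>+x. ennreal ((cmod (v k x - l x))\<^sup>2) \<partial>M)
       = (\<integral>\<^sup>+x. liminf (\<lambda>m. ennreal ((cmod (v k x - v m x))\<^sup>2)) \<partial>M)"
    proof (rule nn_integral_cong_AE)
      show "AE x in M. ennreal ((cmod (v k x - l x))\<^sup>2) = liminf (\<lambda>m. ennreal ((cmod (v k x - v m x))\<^sup>2))"
        using AE_lim
      proof eventually_elim
        case (elim x)
        have "(\<lambda>m. ennreal ((cmod (v k x - v m x))\<^sup>2)) \<longlonglongrightarrow> ennreal ((cmod (v k x - l x))\<^sup>2)"
          by (intro tendsto_intros elim)
        then show ?case by (intro lim_imp_Liminf[symmetric]) simp_all
      qed
    qed
    also have "\<dots> \<le> liminf (\<lambda>m. \<integral>\<^sup>+x. ennreal ((cmod (v k x - v m x))\<^sup>2) \<partial>M)"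
      by (rule nn_integral_liminf) measurable
    also have "\<dots> \<le> liminf (\<lambda>m. ennreal (((1 / 4) ^ k)\<^sup>2))"
    proof (rule Liminf_mono)
      show "\<forall>\<^sub>F m in sequentially.
        (\<integral>\<^sup>+x. ennreal ((cmod (v k x - v m x))\<^sup>2) \<partial>M) \<le> ennreal (((1 / 4) ^ k)\<^sup>2)"
        using eventually_ge_at_top[of k]
      proof eventually_elim
        case (elim m)
        have "(\<integral>x. (cmod (v k x - v m x))\<^sup>2 \<partial>M) \<le> ((1 / 4) ^ k)\<^sup>2"
          using v_v[OF elim] by (subst L2_norm_le_iff[symmetric]) auto
        then show ?case
          using L2_integrable[OF L2_diff[OF v[of k] v[of m]]]
          by (subst nn_integral_eq_integral) (auto intro: ennreal_leI)
      qed
    qed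
    finally show ?thesis by (simp add: Liminf_const)
  qed
  have diff: "(\<lambda>x. v k x - l x) \<in> L2 M" for k
    unfolding L2_def using fatou[of k]
    by (auto intro!: integrableI_bounded simp: power2_eq_square intro: le_less_trans)
  have l: "l \<in> L2 M"
    using L2_diff[OF v[of 0] diff[of 0]] by simp
  have v_l: "L2_norm M (\<lambda>x. v k x - l x) \<le> (1 / 4) ^ k" for k
    using fatou[of k] L2_integrable[OF diff[of k]]
    by (subst L2_norm_le_iff) (auto simp: nn_integral_eq_integral)
  have "(\<lambda>n. L2_norm M (\<lambda>x. u n x - l x)) \<longlonglongrightarrow> 0"
  proof (rule LIMSEQ_I)
    fix e :: real assume "e > 0"
    then obtain k where k: "(1 / 4) ^ k < e / 2"
      using real_arch_pow_inv[of "e / 2" "1 / 4"] by auto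
    have "L2_norm M (\<lambda>x. u n x - l x) < e" if "n \<ge> r k" for n
    proof -
      have "L2_norm M (\<lambda>x. u n x - l x) \<le> L2_norm M (\<lambda>x. u n x - v k x) + L2_norm M (\<lambda>x. v k x - l x)"
        by (intro L2_norm_triangle_diff u v l)
      with v_u[OF that] v_l[of k] k show ?thesis
        by (simp add: L2_norm_minus_commute[of M "u n"])
    qed
    then show "\<exists>n0. \<forall>n\<ge>n0. norm (L2_norm M (\<lambda>x. u n x - l x) - 0) < e" by auto
  qed
  with l show ?thesis by blast
qed

lemma finitely_many_convergent_subsequences:
  fixes c :: "nat \<Rightarrow> 'i \<Rightarrow> complex"
  assumes "finite F" and "\<And>i. i \<in> F \<Longrightarrow> \<exists>B. \<forall>n. cmod (c n i) \<le> B"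
  shows "\<exists>r::nat \<Rightarrow> nat. strict_mono r \<and> (\<forall>i\<in>F. convergent (\<lambda>n. c (r n) i))"
  using assms
proof (induction F rule: finite_induct)
  case empty
  then show ?case by (auto intro: strict_mono_id)
next
  case (insert j F)
  then obtain r :: "nat \<Rightarrow> nat" where r: "strict_mono r" "\<forall>i\<in>F. convergent (\<lambda>n. c (r n) i)"
    by auto
  obtain B where "\<forall>n. cmod (c n j) \<le> B" using insert.prems by blast
  then have "bounded (range (\<lambda>n. c (r n) j))"
    by (auto intro: boundedI)
  then obtain l s where s: "strict_mono s" "((\<lambda>n. c (r n) j) \<circ> s) \<longlonglongrightarrow> l"
    using bounded_imp_convergent_subsequence by blast
  have "convergent (\<lambda>n. c (r (s n)) i)" if "i \<in> insert j F" for i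
  proof (cases "i = j")
    case True then show ?thesis using s by (auto simp: convergent_def o_def)
  next
    case False
    then show ?thesis
      using r that convergent_subseq_convergent[OF _ s(1), of "\<lambda>n. c (r n) i"] by (auto simp: o_def)
  qed
  then show ?case
    using strict_mono_o[OF r(1) s(1)] by (auto simp: o_def)
qed

text \<open>
  A compactness criterion common to the Arzela-Ascoli theorem and to compactness in \<open>L\<^sup>2\<close>: a distance
  that is controlled, up to any given error, by finitely many bounded scalar coordinates admits
  Cauchy subsequences. Bolzano-Weierstrass handles one error bound and a diagonal sequence handles all.
\<close>

lemma Cauchy_subsequence_of_finite_coordinates:
  fixes c :: "nat \<Rightarrow> 'i \<Rightarrow> complex" and d :: "nat \<Rightarrow> nat \<Rightarrow> real"
  assumes bounded: "\<And>i. i \<in> I \<Longrightarrow> \<exists>B. \<forall>n. cmod (c n i) \<le> B"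
    and control: "\<And>e. e > 0 \<Longrightarrow> \<exists>F \<delta>. finite F \<and> F \<subseteq> I \<and> \<delta> > 0 \<and>
      (\<forall>m n. (\<forall>i\<in>F. cmod (c m i - c n i) < \<delta>) \<longrightarrow> d m n < e)"
  shows "\<exists>r :: nat \<Rightarrow> nat. strict_mono r \<and> (\<forall>e>0. \<exists>N. \<forall>m\<ge>N. \<forall>n\<ge>N. d (r m) (r n) < e)"
proof -
  let ?P = "\<lambda>k (s::nat \<Rightarrow> nat). \<forall>m n. d (s m) (s n) < inverse (real (Suc k))"
  interpret subseqs ?P
  proof
    fix k and s :: "nat \<Rightarrow> nat" assume "strict_mono s"
    have "inverse (real (Suc k)) > 0" by simp
    from control[OF this] obtain F \<delta> where F: "finite F" "F \<subseteq> I" "\<delta> > 0"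
      "\<And>m n. (\<forall>i\<in>F. cmod (c m i - c n i) < \<delta>) \<Longrightarrow> d m n < inverse (real (Suc k))"
      by metis
    have "\<exists>B. \<forall>n. cmod (c (s n) i) \<le> B" if "i \<in> F" for i
      using bounded[of i] F(2) that by auto
    from finitely_many_convergent_subsequences[of F "\<lambda>n. c (s n)", OF F(1) this]
    obtain r :: "nat \<Rightarrow> nat" where r: "strict_mono r" "\<forall>i\<in>F. convergent (\<lambda>n. c (s (r n)) i)"
      by auto
    have "\<forall>i\<in>F. \<exists>N. \<forall>m\<ge>N. \<forall>n\<ge>N. cmod (c (s (r m)) i - c (s (r n)) i) < \<delta>"
      using r(2) F(3) by (auto simp: Cauchy_convergent_iff[symmetric] Cauchy_iff)
    then obtain N where N: "\<And>i m n. i \<in> F \<Longrightarrow> m \<ge> N i \<Longrightarrow> n \<ge> N i \<Longrightarrow>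
        cmod (c (s (r m)) i - c (s (r n)) i) < \<delta>"
      by metis
    define K where "K = (\<Sum>i\<in>F. N i)"
    have K: "N i \<le> K" if "i \<in> F" for i
      unfolding K_def using that F(1) by (intro member_le_sum) auto
    have "?P k (s \<circ> (\<lambda>n. r (n + K)))"
    proof (intro allI)
      fix m n
      have "\<forall>i\<in>F. cmod (c (s (r (m + K))) i - c (s (r (n + K))) i) < \<delta>"
        using N K by (meson le_add2 le_trans)
      then show "d ((s \<circ> (\<lambda>n. r (n + K))) m) ((s \<circ> (\<lambda>n. r (n + K))) n) < inverse (real (Suc k))"
        using F(4) by simp
    qed
    moreover have "strict_mono (\<lambda>n. r (n + K))"
      using r(1) by (simp add: strict_mono_def)
    ultimately show "\<exists>r'. strict_mono r' \<and> ?P k (s \<circ> r')" by blast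
  qed
  have holds: "?P k (diagseq \<circ> (+) (Suc k))" for k
    by (rule diagseq_holds) auto
  have "\<exists>N. \<forall>m\<ge>N. \<forall>n\<ge>N. d (diagseq m) (diagseq n) < e" if "e > 0" for e
  proof -
    obtain k where k: "inverse (real (Suc k)) < e"
      using reals_Archimedean[OF \<open>e > 0\<close>] by auto
    have "d (diagseq m) (diagseq n) < e" if "m \<ge> Suc k" "n \<ge> Suc k" for m n
      using holds[of k, rule_format, of "m - Suc k" "n - Suc k"] that k by simp
    then show ?thesis by blast
  qed
  with subseq_diagseq show ?thesis by blast
qed

text \<open>
  The form of the criterion for families of coefficients: the coordinates are Fourier coefficients for the
  Sobolev embedding, and the values of the functions for the diagonal operator.
\<close>

lemma L2_convergent_subsequence_of_square_sums:
  fixes c :: "nat \<Rightarrow> 'i \<Rightarrow> complex"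
  assumes u: "\<And>n. u n \<in> L2 M"
    and bounded: "\<And>i. i \<in> I \<Longrightarrow> \<exists>B. \<forall>n. cmod (c n i) \<le> B"
    and control: "\<And>e. e > 0 \<Longrightarrow> \<exists>F. finite F \<and> F \<subseteq> I \<and>
      (\<forall>m n. (L2_norm M (\<lambda>x. u m x - u n x))\<^sup>2 \<le> e + (\<Sum>i\<in>F. (cmod (c m i - c n i))\<^sup>2))"
  shows "L2_convergent_subsequence M u"
proof -
  define d where "d = (\<lambda>m n. L2_norm M (\<lambda>x. u m x - u n x))"
  have "\<exists>r :: nat \<Rightarrow> nat. strict_mono r \<and> (\<forall>e>0. \<exists>N. \<forall>m\<ge>N. \<forall>n\<ge>N. d (r m) (r n) < e)"
  proof (rule Cauchy_subsequence_of_finite_coordinates[OF bounded])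
    fix e :: real assume e: "e > 0"
    then obtain F where F: "finite F" "F \<subseteq> I"
      "\<And>m n. (d m n)\<^sup>2 \<le> e\<^sup>2 / 2 + (\<Sum>i\<in>F. (cmod (c m i - c n i))\<^sup>2)"
      using control[of "e\<^sup>2 / 2"] unfolding d_def by (meson half_gt_zero zero_less_power)
    (* The square of \<delta>, summed over F, is at most e^2 / 4. *)
    define \<delta> where "\<delta> = e / (2 * sqrt (real (card F) + 1))"
    have \<delta>: "\<delta> > 0" using e by (simp add: \<delta>_def)
    have \<delta>2: "real (card F) * \<delta>\<^sup>2 \<le> e\<^sup>2 / 4"
    proof -
      have "real (card F) * \<delta>\<^sup>2 \<le> (real (card F) + 1) * \<delta>\<^sup>2" by (intro mult_right_mono) auto
      also have "\<dots> = e\<^sup>2 / 4" by (simp add: \<delta>_def power_divide power_mult_distrib field_simps)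
      finally show ?thesis .
    qed
    have "d m n < e" if close: "\<forall>i\<in>F. cmod (c m i - c n i) < \<delta>" for m n
    proof -
      have "(\<Sum>i\<in>F. (cmod (c m i - c n i))\<^sup>2) \<le> (\<Sum>i\<in>F. \<delta>\<^sup>2)"
        using close by (intro sum_mono power_mono) (auto intro: less_imp_le)
      then have "(d m n)\<^sup>2 \<le> e\<^sup>2 / 2 + e\<^sup>2 / 4" using F(3)[of m n] \<delta>2 by simp
      also have "\<dots> < e\<^sup>2" using e by (simp add: field_simps)
      finally show ?thesis using e by (simp add: power2_less_imp_less)
    qed
    then show "\<exists>F \<delta>. finite F \<and> F \<subseteq> I \<and> \<delta> > 0 \<and>
      (\<forall>m n. (\<forall>i\<in>F. cmod (c m i - c n i) < \<delta>) \<longrightarrow> d m n < e)"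
      using F(1,2) \<delta> by (intro exI[of _ F] exI[of _ \<delta>]) simp
  qed
  then obtain r :: "nat \<Rightarrow> nat" where r: "strict_mono r"
    and "\<And>e. e > 0 \<Longrightarrow> \<exists>N. \<forall>m\<ge>N. \<forall>n\<ge>N. L2_norm M (\<lambda>x. u (r m) x - u (r n) x) < e"
    unfolding d_def by blast
  then obtain l where "l \<in> L2 M" "(\<lambda>n. L2_norm M (\<lambda>x. u (r n) x - l x)) \<longlonglongrightarrow> 0"
    using L2_complete[of "\<lambda>n. u (r n)" M] u by blast
  with r show ?thesis unfolding L2_convergent_subsequence_def by blast
qed

lemma separated_no_L2_convergent_subsequence:
  assumes u: "\<And>n. u n \<in> L2 M" and d: "d > 0"
    and sep: "\<And>m n. m \<noteq> n \<Longrightarrow> d \<le> L2_norm M (\<lambda>x. u m x - u n x)"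
  shows "\<not> L2_convergent_subsequence M u"
proof
  assume "L2_convergent_subsequence M u"
  then obtain r l where r: "strict_mono r" and l: "l \<in> L2 M"
    and lim: "(\<lambda>n. L2_norm M (\<lambda>x. u (r n) x - l x)) \<longlonglongrightarrow> 0"
    unfolding L2_convergent_subsequence_def by blast
  from order_tendstoD(2)[OF lim, of "d / 2"] d
  obtain N where N: "\<And>n. n \<ge> N \<Longrightarrow> L2_norm M (\<lambda>x. u (r n) x - l x) < d / 2"
    by (auto simp: eventually_sequentially)
  have "L2_norm M (\<lambda>x. u (r N) x - u (r (Suc N)) x)
    \<le> L2_norm M (\<lambda>x. u (r N) x - l x) + L2_norm M (\<lambda>x. l x - u (r (Suc N)) x)"
    by (intro L2_norm_triangle_diff u l)
  also have "\<dots> < d"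
    using N[of N] N[of "Suc N"] by (simp add: L2_norm_minus_commute[of M l])
  finally show False
    using sep[of "r N" "r (Suc N)"] strict_mono_eq[OF r, of N "Suc N"] by simp
qed

section \<open>Diagonal operators on square-summable families\<close>

lemma sum_le_integral_count_space:
  fixes f :: "'b \<Rightarrow> real"
  assumes f: "integrable (count_space A) f" "\<And>x. x \<in> A \<Longrightarrow> f x \<ge> 0" and G: "finite G" "G \<subseteq> A"
  shows "sum f G \<le> (\<integral>x. f x \<partial>count_space A)"
proof -
  have ind: "integrable (count_space A) (\<lambda>x. f x * indicator G x)"
    using G by (intro integrable_real_mult_indicator f) auto
  have "sum f G = (\<Sum>x\<in>{x\<in>A. f x * indicator G x \<noteq> 0}. f x * indicator G x)"
    using G by (intro sum.mono_neutral_cong_right) (auto simp: indicator_def)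
  also have "\<dots> = (\<integral>x. f x * indicator G x \<partial>count_space A)"
    by (rule lebesgue_integral_count_space_finite_support[symmetric])
      (rule finite_subset[OF _ G(1)], auto simp: indicator_def)
  also have "\<dots> \<le> (\<integral>x. f x \<partial>count_space A)"
    using f by (intro integral_mono ind) (auto simp: indicator_def)
  finally show ?thesis .
qed

lemma integrable_count_space_finite_support:
  fixes f :: "'b \<Rightarrow> real"
  assumes G: "finite G" "\<And>x. x \<in> A \<Longrightarrow> x \<notin> G \<Longrightarrow> f x = 0"
  shows "integrable (count_space A) f"
proof -
  have "integrable (count_space A) (\<lambda>x. \<Sum>y\<in>G \<inter> A. f y * indicator {y} x)"
    by (intro Bochner_Integration.integrable_sum integrable_mult_right integrable_real_indicator) auto
  moreover have "(\<Sum>y\<in>G \<inter> A. f y * indicator {y} x) = f x" if "x \<in> A" for x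
  proof -
    have "(\<Sum>y\<in>G \<inter> A. f y * indicator {y} x) = (\<Sum>y\<in>G \<inter> A. if y = x then f y else 0)"
      by (intro sum.cong) (auto simp: indicator_def)
    then show ?thesis using G that by auto
  qed
  ultimately show ?thesis
    by (subst Bochner_Integration.integrable_cong[OF refl, of _ _ "\<lambda>x. \<Sum>y\<in>G \<inter> A. f y * indicator {y} x"]) auto
qed

lemma L2_count_space_pointwise_bound:
  assumes "f \<in> L2 (count_space A)" "x \<in> A"
  shows "cmod (f x) \<le> L2_norm (count_space A) f"
proof -
  have "(cmod (f x))\<^sup>2 \<le> (L2_norm (count_space A) f)\<^sup>2"
    using sum_le_integral_count_space[OF L2_integrable[OF assms(1)], of "{x}"] assms(2)
    by (simp add: L2_norm_square)
  then show ?thesis by (rule power2_le_imp_le) simp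
qed

text \<open>
  Unit vectors at points of an infinite sublevel set have images whose mutual distances are bounded below. If
  the sublevel sets are finite, then outside \<open>F = {\<xi> \<in> D. 1 + \<gamma>(\<xi>)\<^sup>2 \<le> R}\<close> the operator shrinks squared norms by the
  factor \<open>1 / R\<close>, so that differences of images are controlled by the coordinates in \<open>F\<close>.
\<close>

lemma diagonal_operator_compact_iff:
  fixes \<gamma> :: "'b \<Rightarrow> real"
  shows "L2_compact_operator (count_space D) (\<lambda>f \<xi>. f \<xi> / complex_of_real (sqrt (1 + (\<gamma> \<xi>)\<^sup>2)))
    \<longleftrightarrow> (\<forall>R. finite {\<xi>\<in>D. 1 + (\<gamma> \<xi>)\<^sup>2 \<le> R})"
    (is "L2_compact_operator ?M ?T \<longleftrightarrow> ?finite")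
proof
  have T_sq: "(cmod (?T f \<xi>))\<^sup>2 = (cmod (f \<xi>))\<^sup>2 / (1 + (\<gamma> \<xi>)\<^sup>2)" for f \<xi>
    by (simp add: norm_divide power_divide)
  have T_L2: "?T f \<in> L2 ?M" if "f \<in> L2 ?M" for f
  proof -
    have "(cmod (f \<xi>))\<^sup>2 / (1 + (\<gamma> \<xi>)\<^sup>2) \<le> (cmod (f \<xi>))\<^sup>2 / 1" for \<xi>
      by (intro divide_left_mono) (auto simp: add_pos_nonneg)
    then have "integrable ?M (\<lambda>\<xi>. (cmod (?T f \<xi>))\<^sup>2)"
      unfolding T_sq by (intro Bochner_Integration.integrable_bound[OF L2_integrable[OF that]]) auto
    then show ?thesis by (simp add: L2_def)
  qed
  {
    assume compact: "L2_compact_operator ?M ?T"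
    show ?finite
    proof (rule allI, rule ccontr)
      fix R assume "infinite {\<xi>\<in>D. 1 + (\<gamma> \<xi>)\<^sup>2 \<le> R}"
      then obtain x :: "nat \<Rightarrow> 'b" where x: "inj x" "range x \<subseteq> {\<xi>\<in>D. 1 + (\<gamma> \<xi>)\<^sup>2 \<le> R}"
        using infinite_countable_subset by blast
      then have xD: "x n \<in> D" "1 + (\<gamma> (x n))\<^sup>2 \<le> R" for n by auto
      have R: "R > 0" using xD(2)[of 0] by (smt (verit) zero_le_power2)
      define u where "u = (\<lambda>n \<xi>. indicator {x n} \<xi> :: complex)"
      have u: "u n \<in> L2 ?M" for n
        unfolding L2_def u_def
        by (auto intro!: integrable_count_space_finite_support[of "{x n}"] simp: indicator_def)
      have "L2_norm ?M (u n) \<le> 1" for n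
      proof -
        have "(\<integral>\<xi>. (cmod (u n \<xi>))\<^sup>2 \<partial>?M) = (\<Sum>\<xi>\<in>{\<xi>\<in>D. (cmod (u n \<xi>))\<^sup>2 \<noteq> 0}. (cmod (u n \<xi>))\<^sup>2)"
          by (rule lebesgue_integral_count_space_finite_support)
            (rule finite_subset[of _ "{x n}"], auto simp: u_def indicator_def)
        also have "{\<xi>\<in>D. (cmod (u n \<xi>))\<^sup>2 \<noteq> 0} = {x n}"
          using xD by (auto simp: u_def indicator_def)
        finally show ?thesis by (simp add: L2_norm_le_iff u_def)
      qed
      with u compact have "L2_convergent_subsequence ?M (\<lambda>n. ?T (u n))"
        unfolding L2_compact_operator_def by blast
      moreover have "\<not> L2_convergent_subsequence ?M (\<lambda>n. ?T (u n))"
      proof (rule separated_no_L2_convergent_subsequence)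
        show "?T (u n) \<in> L2 ?M" for n by (rule T_L2[OF u])
        show "1 / sqrt R > 0" using R by simp
        fix m n :: nat assume "m \<noteq> n"
        then have ne: "x m \<noteq> x n" using x(1) by (auto dest: injD)
        have "1 / sqrt R \<le> 1 / sqrt (1 + (\<gamma> (x m))\<^sup>2)"
          using xD(2)[of m] R by (intro divide_left_mono mult_pos_pos) (auto simp: add_pos_nonneg)
        also have "\<dots> = cmod (?T (u m) (x m) - ?T (u n) (x m))"
          using ne by (simp add: u_def norm_divide)
        also have "\<dots> \<le> L2_norm ?M (\<lambda>\<xi>. ?T (u m) \<xi> - ?T (u n) \<xi>)"
          by (rule L2_count_space_pointwise_bound[OF L2_diff[OF T_L2[OF u] T_L2[OF u]] xD(1)])
        finally show "1 / sqrt R \<le> L2_norm ?M (\<lambda>\<xi>. ?T (u m) \<xi> - ?T (u n) \<xi>)" .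
      qed
      ultimately show False by blast
    qed
  next
    assume fin: ?finite
    have conv: "L2_convergent_subsequence ?M (\<lambda>n. ?T (u n))"
      if u: "\<And>n. u n \<in> L2 ?M" and B: "\<And>n. L2_norm ?M (u n) \<le> B" for u B
    proof (rule L2_convergent_subsequence_of_square_sums[where I = D and c = u])
      show "?T (u n) \<in> L2 ?M" for n by (rule T_L2[OF u])
      show "\<exists>B. \<forall>n. cmod (u n \<xi>) \<le> B" if "\<xi> \<in> D" for \<xi>
        by (intro exI[of _ B] allI order_trans[OF L2_count_space_pointwise_bound[OF u that] B])
      fix e :: real assume e: "e > 0"
      (* The contribution from outside F will be at most 4 B^2 / R; adding 1 keeps R positive when B is 0. *)
      define R where "R = 4 * B\<^sup>2 / e + 1"
      have "4 * B\<^sup>2 / e \<ge> 0" using e by simp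
      then have "R > 0" by (simp add: R_def)
      moreover have "4 * B\<^sup>2 \<le> e * R" using e by (simp add: R_def distrib_left)
      ultimately have R: "R > 0" "4 * B\<^sup>2 / R \<le> e" by (simp_all add: divide_le_eq)
      define F where "F = {\<xi>\<in>D. 1 + (\<gamma> \<xi>)\<^sup>2 \<le> R}"
      have F: "finite F" "F \<subseteq> D" using fin by (auto simp: F_def)
      have "(L2_norm ?M (\<lambda>\<xi>. ?T (u m) \<xi> - ?T (u n) \<xi>))\<^sup>2 \<le> e + (\<Sum>\<xi>\<in>F. (cmod (u m \<xi> - u n \<xi>))\<^sup>2)" for m n
      proof -
        have bd: "(cmod (u m \<xi> - u n \<xi>))\<^sup>2 / (1 + (\<gamma> \<xi>)\<^sup>2)
          \<le> (cmod (u m \<xi> - u n \<xi>))\<^sup>2 * indicator F \<xi> + 2 / R * ((cmod (u m \<xi>))\<^sup>2 + (cmod (u n \<xi>))\<^sup>2)"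
          (is "?l \<le> ?r") if "\<xi> \<in> D" for \<xi>
        proof (cases "\<xi> \<in> F")
          case True
          have "?l \<le> (cmod (u m \<xi> - u n \<xi>))\<^sup>2 / 1"
            by (intro divide_left_mono) (auto simp: add_pos_nonneg)
          also have "\<dots> \<le> ?r" using True R by simp
          finally show ?thesis .
        next
          case False
          then have "?l \<le> (cmod (u m \<xi> - u n \<xi>))\<^sup>2 / R"
            using that R by (intro divide_left_mono mult_pos_pos) (auto simp: F_def add_pos_nonneg)
          also have "\<dots> \<le> (2 * (cmod (u m \<xi>))\<^sup>2 + 2 * (cmod (u n \<xi>))\<^sup>2) / R"
            using R by (intro divide_right_mono cmod_diff_square_le) auto
          also have "\<dots> = ?r" using False by (simp add: field_simps)
          finally show ?thesis .
        qed
        note i = L2_integrable[OF u] L2_integrable[OF L2_diff[OF u[of m] u[of n]]]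
        have iF: "integrable ?M (\<lambda>\<xi>. (cmod (u m \<xi> - u n \<xi>))\<^sup>2 * indicator F \<xi>)"
          by (rule integrable_count_space_finite_support[OF F(1)]) auto
        have sq: "(cmod (?T (u m) \<xi> - ?T (u n) \<xi>))\<^sup>2 = (cmod (u m \<xi> - u n \<xi>))\<^sup>2 / (1 + (\<gamma> \<xi>)\<^sup>2)" for \<xi>
          using T_sq[of "\<lambda>\<xi>. u m \<xi> - u n \<xi>" \<xi>] by (simp only: diff_divide_distrib)
        have "(L2_norm ?M (\<lambda>\<xi>. ?T (u m) \<xi> - ?T (u n) \<xi>))\<^sup>2
          = (\<integral>\<xi>. (cmod (u m \<xi> - u n \<xi>))\<^sup>2 / (1 + (\<gamma> \<xi>)\<^sup>2) \<partial>?M)"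
          by (simp only: L2_norm_square sq)
        also have "\<dots> \<le> (\<integral>\<xi>. (cmod (u m \<xi> - u n \<xi>))\<^sup>2 * indicator F \<xi>
            + 2 / R * ((cmod (u m \<xi>))\<^sup>2 + (cmod (u n \<xi>))\<^sup>2) \<partial>?M)"
        proof (rule integral_mono)
          show "integrable ?M (\<lambda>\<xi>. (cmod (u m \<xi> - u n \<xi>))\<^sup>2 / (1 + (\<gamma> \<xi>)\<^sup>2))"
            using L2_integrable[OF L2_diff[OF T_L2[OF u[of m]] T_L2[OF u[of n]]]] by (simp only: sq)
          show "integrable ?M (\<lambda>\<xi>. (cmod (u m \<xi> - u n \<xi>))\<^sup>2 * indicator F \<xi>
            + 2 / R * ((cmod (u m \<xi>))\<^sup>2 + (cmod (u n \<xi>))\<^sup>2))"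
            by (intro Bochner_Integration.integrable_add integrable_mult_right iF i)
        qed (use bd in auto)
        also have "\<dots> = (\<integral>\<xi>. (cmod (u m \<xi> - u n \<xi>))\<^sup>2 * indicator F \<xi> \<partial>?M)
            + 2 / R * ((L2_norm ?M (u m))\<^sup>2 + (L2_norm ?M (u n))\<^sup>2)"
          unfolding L2_norm_square using i(1) iF
          by (simp add: Bochner_Integration.integral_add)
        also have "(\<integral>\<xi>. (cmod (u m \<xi> - u n \<xi>))\<^sup>2 * indicator F \<xi> \<partial>?M) = (\<Sum>\<xi>\<in>F. (cmod (u m \<xi> - u n \<xi>))\<^sup>2)"
          using F by (subst lebesgue_integral_count_space_finite_support)
            (auto intro!: sum.mono_neutral_cong_left simp: indicator_def)
        also have "2 / R * ((L2_norm ?M (u m))\<^sup>2 + (L2_norm ?M (u n))\<^sup>2) \<le> 2 / R * (B\<^sup>2 + B\<^sup>2)"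
          using R B by (intro mult_left_mono add_mono power_mono) auto
        also have "\<dots> \<le> e" using R(2) by simp
        finally show ?thesis by simp
      qed
      with F show "\<exists>F. finite F \<and> F \<subseteq> D \<and> (\<forall>m n. (L2_norm ?M (\<lambda>\<xi>. ?T (u m) \<xi> - ?T (u n) \<xi>))\<^sup>2
          \<le> e + (\<Sum>\<xi>\<in>F. (cmod (u m \<xi> - u n \<xi>))\<^sup>2))" by (intro exI[of _ F]) simp
    qed
    have "L2_convergent_subsequence ?M (\<lambda>n. ?T (u n))"
      if u: "(\<forall>n. u n \<in> L2 ?M) \<and> (\<exists>B. \<forall>n. L2_norm ?M (u n) \<le> B)" for u
    proof -
      obtain B where "\<forall>n. L2_norm ?M (u n) \<le> B" using u[THEN conjunct2] ..
      with u show ?thesis by (intro conv[of u B]) simp_all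
    qed
    then show "L2_compact_operator ?M ?T"
      unfolding L2_compact_operator_def
      by (intro conjI ballI allI impI T_L2) (simp_all add: add_divide_distrib)
  }
qed

section \<open>Characters and trigonometric polynomials\<close>

lemma dual_groupD:
  assumes "\<xi> \<in> dual_group"
  shows "continuous_on UNIV \<xi>" "cmod (\<xi> x) = 1" "\<xi> (x + y) = \<xi> x * \<xi> y"
proof -
  have "range \<xi> \<subseteq> sphere 0 1" using assms by (simp add: dual_group_def)
  then have "\<xi> x \<in> sphere 0 1" by blast
  then show "cmod (\<xi> x) = 1" by simp
qed (use assms in \<open>simp_all add: dual_group_def\<close>)

lemma dual_group_mult:
  assumes "\<xi> \<in> dual_group" "\<eta> \<in> dual_group" shows "(\<lambda>x. \<xi> x * \<eta> x) \<in> dual_group"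
  using assms dual_groupD[OF assms(1)] dual_groupD[OF assms(2)]
  unfolding dual_group_def by (auto simp: norm_mult intro!: continuous_intros)

lemma dual_group_cnj:
  assumes "\<xi> \<in> dual_group" shows "(\<lambda>x. cnj (\<xi> x)) \<in> dual_group"
  using dual_groupD[OF assms] unfolding dual_group_def by (auto intro!: continuous_intros)

lemma dual_group_one: "(\<lambda>_. 1) \<in> dual_group"
  by (auto simp: dual_group_def)

lemma dual_group_zero: "\<xi> \<in> dual_group \<Longrightarrow> \<xi> 0 = 1"
  using dual_groupD(3)[of \<xi> 0 0] dual_groupD(2)[of \<xi> 0] by auto

lemma dual_group_uminus:
  assumes "\<xi> \<in> dual_group" shows "\<xi> (- a) = cnj (\<xi> a)"
proof -
  have "\<xi> (- a) * \<xi> a = 1"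
    using dual_groupD(3)[OF assms, of "- a" a] dual_group_zero[OF assms] by simp
  moreover have "cnj (\<xi> a) * \<xi> a = 1"
    using dual_groupD(2)[OF assms, of a] by (simp add: mult.commute[of "cnj _"] complex_norm_square[symmetric])
  moreover have "\<xi> a \<noteq> 0" using dual_groupD(2)[OF assms, of a] by auto
  ultimately show ?thesis by (metis mult_right_cancel)
qed

inductive_set trigonometric_polynomials :: "('a::topological_ab_group_add \<Rightarrow> complex) set" where
  character: "\<xi> \<in> dual_group \<Longrightarrow> (\<lambda>x. c * \<xi> x) \<in> trigonometric_polynomials"
| add: "p \<in> trigonometric_polynomials \<Longrightarrow> q \<in> trigonometric_polynomials \<Longrightarrow>
    (\<lambda>x. p x + q x) \<in> trigonometric_polynomials"

lemma trigonometric_polynomial_continuous: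
  "p \<in> trigonometric_polynomials \<Longrightarrow> continuous_on UNIV p"
  by (induction rule: trigonometric_polynomials.induct)
    (simp_all add: continuous_on_add continuous_on_mult_left dual_groupD(1))

lemma trigonometric_polynomial_mult:
  assumes "p \<in> trigonometric_polynomials" "q \<in> trigonometric_polynomials"
  shows "(\<lambda>x. p x * q x) \<in> trigonometric_polynomials"
  using assms(1)
proof (induction rule: trigonometric_polynomials.induct)
  case (character \<xi> c)
  note \<xi> = this
  show ?case using assms(2)
  proof (induction rule: trigonometric_polynomials.induct)
    case (character \<eta> d)
    have "(\<lambda>x. (c * d) * (\<xi> x * \<eta> x)) \<in> trigonometric_polynomials"
      by (intro trigonometric_polynomials.character dual_group_mult \<xi> character)
    then show ?case by (simp add: mult_ac)
  next
    case (add p q)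
    then show ?case using trigonometric_polynomials.add[OF add.IH] by (simp add: distrib_left)
  qed
next
  case (add p q)
  then show ?case using trigonometric_polynomials.add[OF add.IH] by (simp add: distrib_right)
qed

lemma trigonometric_polynomial_scale:
  "p \<in> trigonometric_polynomials \<Longrightarrow> (\<lambda>x. c * p x) \<in> trigonometric_polynomials"
  using trigonometric_polynomial_mult[OF trigonometric_polynomials.character[OF dual_group_one, of c]]
  by simp

text \<open>
  The inductive description suits the algebra structure needed for Stone-Weierstrass, a sum over distinct
  characters suits orthogonality; this passes from the first to the second.
\<close>

lemma trigonometric_polynomial_eq_sum:
  assumes "p \<in> trigonometric_polynomials"
  shows "\<exists>F c. finite F \<and> F \<subseteq> dual_group \<and> p = (\<lambda>x. \<Sum>\<xi>\<in>F. c \<xi> * \<xi> x)"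
  using assms
proof (induction rule: trigonometric_polynomials.induct)
  case (character \<xi> c)
  then show ?case by (intro exI[of _ "{\<xi>}"] exI[of _ "\<lambda>_. c"]) auto
next
  case (add p q)
  then obtain F c G d where F: "finite F" "F \<subseteq> dual_group" "p = (\<lambda>x. \<Sum>\<xi>\<in>F. c \<xi> * \<xi> x)"
    and G: "finite G" "G \<subseteq> dual_group" "q = (\<lambda>x. \<Sum>\<xi>\<in>G. d \<xi> * \<xi> x)" by auto
  have extend: "(\<Sum>\<xi>\<in>H. e \<xi> * \<xi> x) = (\<Sum>\<xi>\<in>F \<union> G. (if \<xi> \<in> H then e \<xi> else 0) * \<xi> x)"
    if "H \<subseteq> F \<union> G" for H e x
    using that F(1) G(1) by (intro sum.mono_neutral_cong_left) auto
  have "p x + q x = (\<Sum>\<xi>\<in>F \<union> G. ((if \<xi> \<in> F then c \<xi> else 0) + (if \<xi> \<in> G then d \<xi> else 0)) * \<xi> x)" for x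
    unfolding F(3) G(3) using extend[of F] extend[of G] by (simp add: distrib_right sum.distrib)
  then show ?case
    using F(1,2) G(1,2) by (intro exI[of _ "F \<union> G"] exI[of _ "\<lambda>\<xi>. (if \<xi> \<in> F then c \<xi> else 0) + (if \<xi> \<in> G then d \<xi> else 0)"]) auto
qed

section \<open>Continuous functions on a compact Abelian group\<close>

definition convolution :: "'a::topological_ab_group_add measure \<Rightarrow> ('a \<Rightarrow> complex) \<Rightarrow> ('a \<Rightarrow> complex) \<Rightarrow> 'a \<Rightarrow> complex" where
  "convolution \<mu> g w x = (\<integral>y. g (x - y) * w y \<partial>\<mu>)"

text \<open>
  Its Fourier coefficients are the squared absolute values of those of \<open>u\<close>.
\<close>

definition autocorrelation :: "'a::topological_ab_group_add measure \<Rightarrow> ('a \<Rightarrow> complex) \<Rightarrow> 'a \<Rightarrow> complex" where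
  "autocorrelation \<mu> u x = (\<integral>z. u (x + z) * cnj (u z) \<partial>\<mu>)"

lemma continuous_on_translate:
  fixes f :: "'a::topological_ab_group_add \<Rightarrow> 'b::topological_space"
  assumes "continuous_on UNIV f"
  shows "continuous_on UNIV (\<lambda>x. f (x + a))" "continuous_on UNIV (\<lambda>x. f (a + x))"
    "continuous_on UNIV (\<lambda>x. f (a - x))" "continuous_on UNIV (\<lambda>x. f (x - a))"
    "continuous_on UNIV (\<lambda>x. f (- x))"
  by (auto intro!: continuous_on_compose2[OF assms] continuous_intros)

locale compact_group_haar =
  fixes \<mu> :: "'a::{topological_ab_group_add, t2_space} measure"
  assumes compact_UNIV: "compact (UNIV :: 'a set)"
    and haar: "normalized_haar_measure \<mu>"
begin

lemma sets_haar [measurable_cong, simp]: "sets \<mu> = sets borel"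
  using haar by (simp add: normalized_haar_measure_def)

lemma space_haar [simp]: "space \<mu> = UNIV"
  using sets_eq_imp_space_eq[OF sets_haar] by simp

lemma emeasure_haar_UNIV [simp]: "emeasure \<mu> UNIV = 1"
  using haar by (simp add: normalized_haar_measure_def)

lemma emeasure_translate: "A \<in> sets borel \<Longrightarrow> emeasure \<mu> ((+) a ` A) = emeasure \<mu> A"
  using haar[unfolded normalized_haar_measure_def, THEN conjunct2, THEN conjunct2, THEN conjunct1]
  by (rule allE[of _ a]) (erule bspec)

lemma measure_haar_UNIV [simp]: "measure \<mu> UNIV = 1"
  by (simp add: measure_def)

sublocale finite_measure \<mu>
  by standard simp

lemma translation_invariant:
  assumes [measurable]: "f \<in> borel_measurable borel"
  shows "(\<integral>x. f (x + a) \<partial>\<mu>) = (\<integral>x. f x \<partial>\<mu> :: complex)"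
proof -
  have [measurable]: "(\<lambda>x. x + a) \<in> borel_measurable borel"
    by (intro borel_measurable_continuous_onI continuous_intros)
  have "distr \<mu> borel (\<lambda>x. x + a) = \<mu>"
  proof (rule measure_eqI)
    fix A assume "A \<in> sets (distr \<mu> borel (\<lambda>x. x + a))"
    then have A: "A \<in> sets borel" by simp
    have "emeasure (distr \<mu> borel (\<lambda>x. x + a)) A = emeasure \<mu> ((\<lambda>x. x + a) -` A)"
      using A by (subst emeasure_distr) auto
    also have "(\<lambda>x. x + a) -` A = (+) (- a) ` A"
      by (auto simp: image_iff algebra_simps intro: bexI[of _ "_ + a"])
    also have "emeasure \<mu> \<dots> = emeasure \<mu> A"
      using A by (rule emeasure_translate)
    finally show "emeasure (distr \<mu> borel (\<lambda>x. x + a)) A = emeasure \<mu> A" .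
  qed simp
  then have "(\<integral>x. f x \<partial>\<mu>) = (\<integral>x. f x \<partial>distr \<mu> borel (\<lambda>x. x + a))" by simp
  also have "\<dots> = (\<integral>x. f (x + a) \<partial>\<mu>)"
    by (rule integral_distr) auto
  finally show ?thesis by simp
qed

lemma continuous_measurable:
  "continuous_on UNIV (f :: 'a \<Rightarrow> 'b::topological_space) \<Longrightarrow> f \<in> borel_measurable borel"
  by (rule borel_measurable_continuous_onI)

lemma continuous_translation_invariant:
  "continuous_on UNIV f \<Longrightarrow> (\<integral>x. f (x + a) \<partial>\<mu>) = (\<integral>x. f x \<partial>\<mu> :: complex)"
  by (intro translation_invariant continuous_measurable)

lemma continuous_bounded:
  assumes "continuous_on UNIV (f :: 'a \<Rightarrow> 'b::real_normed_vector)"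
  obtains B where "B > 0" "\<And>x. norm (f x) \<le> B"
proof -
  have "bounded (range f)"
    using assms compact_UNIV by (intro compact_imp_bounded compact_continuous_image)
  then show ?thesis using that by (auto simp: bounded_pos)
qed

lemma continuous_integrable:
  fixes f :: "'a \<Rightarrow> 'b::{banach, second_countable_topology}"
  assumes "continuous_on UNIV f" shows "integrable \<mu> f"
proof -
  obtain B where "\<And>x. norm (f x) \<le> B" using continuous_bounded[OF assms] by blast
  moreover have "f \<in> borel_measurable \<mu>" using continuous_measurable[OF assms] by simp
  ultimately show ?thesis by (intro integrable_const_bound[of _ B]) auto
qed

lemma integral_norm_le:
  fixes f :: "'a \<Rightarrow> 'b::{banach, second_countable_topology}"
  assumes "continuous_on UNIV f" "\<And>x. norm (f x) \<le> B"
  shows "norm (\<integral>x. f x \<partial>\<mu>) \<le> B"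
proof -
  have "norm (\<integral>x. f x \<partial>\<mu>) \<le> (\<integral>x. norm (f x) \<partial>\<mu>)" by (rule integral_norm_bound)
  also have "\<dots> \<le> (\<integral>x. B \<partial>\<mu>)"
    using assms by (intro integral_mono continuous_integrable continuous_on_norm) auto
  finally show ?thesis by simp
qed

lemma continuous_L2: assumes "continuous_on UNIV f" shows "f \<in> L2 \<mu>"
  unfolding L2_def using continuous_measurable[OF assms]
  by (auto intro!: continuous_integrable continuous_intros assms)

lemma L2_norm_le_sup:
  assumes "continuous_on UNIV f" "B \<ge> 0" "\<And>x. cmod (f x) \<le> B" shows "L2_norm \<mu> f \<le> B"
proof -
  have "norm (\<integral>x. (cmod (f x))\<^sup>2 \<partial>\<mu>) \<le> B\<^sup>2"
    by (intro integral_norm_le continuous_intros assms) (simp add: assms power_mono)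
  then show ?thesis using assms(2) by (simp add: L2_norm_le_iff)
qed

lemma L1_norm_le_L2_norm:
  assumes "f \<in> L2 \<mu>" shows "(\<integral>x. cmod (f x) \<partial>\<mu>) \<le> L2_norm \<mu> f"
proof -
  have [measurable]: "f \<in> borel_measurable borel"
    using L2_measurable[OF assms] by simp
  have abs: "(\<lambda>x. complex_of_real (cmod (f x))) \<in> L2 \<mu>"
    using L2_integrable[OF assms] by (auto simp: L2_def)
  have "Re (L2_inner \<mu> (\<lambda>x. complex_of_real (cmod (f x))) (\<lambda>_. 1)) \<le>
    L2_norm \<mu> (\<lambda>x. complex_of_real (cmod (f x))) * L2_norm \<mu> (\<lambda>_. 1)"
    by (intro Re_L2_inner_le continuous_L2 abs continuous_intros)
  then show ?thesis
    by (simp add: L2_inner_def L2_norm_def)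
qed

text \<open>
  Haar measure charges every nonempty open set, because finitely many translates of such a set cover the
  group. So for continuous functions vanishing almost everywhere means vanishing.
\<close>

lemma L2_norm_eq_0_imp:
  assumes f: "continuous_on UNIV f" and 0: "L2_norm \<mu> f = 0" shows "f x = 0"
proof (rule ccontr)
  assume x: "f x \<noteq> 0"
  define U where "U = {x. f x \<noteq> 0}"
  have oU: "open U"
    unfolding U_def using f by (intro open_Collect_neq) auto
  have "(\<integral>x. (cmod (f x))\<^sup>2 \<partial>\<mu>) = 0"
    using 0 by (simp add: L2_norm_def)
  then have "AE x in \<mu>. (cmod (f x))\<^sup>2 = 0"
    by (subst (asm) integral_nonneg_eq_0_iff_AE) (auto intro: L2_integrable continuous_L2 f)
  then have "AE x in \<mu>. x \<notin> U" by (auto simp: U_def)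
  then have null: "emeasure \<mu> U = 0"
    using oU by (subst (asm) AE_iff_measurable[of U]) (auto simp: U_def)
  have trans: "emeasure \<mu> ((+) a ` U) = 0" for a
    using emeasure_translate[of U a] oU null by simp
  have op: "open ((+) a ` U)" for a
  proof -
    have "(+) a ` U = (\<lambda>y. y - a) -` U"
      by (force simp: image_iff)
    moreover have "open ((\<lambda>y. y - a) -` U)"
      by (intro open_vimage oU continuous_intros)
    ultimately show ?thesis by simp
  qed
  have "UNIV \<subseteq> (\<Union>a. (+) a ` U)"
  proof
    fix y show "y \<in> (\<Union>a. (+) a ` U)"
      using x by (intro UN_I[of "y - x"] image_eqI[of _ _ x]) (simp_all add: U_def)
  qed
  then obtain C where C: "finite C" "UNIV \<subseteq> (\<Union>a\<in>C. (+) a ` U)"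
    using compactE_image[OF compact_UNIV, of UNIV "\<lambda>a. (+) a ` U"] op by metis
  have "emeasure \<mu> (\<Union>a\<in>C. (+) a ` U) \<le> (\<Sum>a\<in>C. emeasure \<mu> ((+) a ` U))"
    using C(1) op by (intro emeasure_subadditive_finite) auto
  also have "\<dots> = 0" by (simp add: trans)
  also have "(\<Union>a\<in>C. (+) a ` U) = UNIV" using C(2) by auto
  finally show False by simp
qed

text \<open>
  Uniform continuity for the translation structure, from the tube lemma: the set of \<open>(v, x)\<close> where the oscillation
  is below \<open>e\<close> is an open neighbourhood of the compact slice over \<open>v = 0\<close>.
\<close>

lemma uniform_continuity:
  fixes g :: "'a \<Rightarrow> complex"
  assumes "continuous_on UNIV g" "e > 0"
  obtains V where "open V" "0 \<in> V" "\<And>v x. v \<in> V \<Longrightarrow> cmod (g (x + v) - g x) < e"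
proof -
  let ?W = "{p. cmod (g (snd p + fst p) - g (snd p)) < e}"
  have "open ?W"
    by (intro open_Collect_less continuous_intros continuous_on_compose2[OF assms(1)]) auto
  moreover have "{0} \<times> UNIV \<subseteq> ?W" using assms(2) by auto
  ultimately obtain V where "0 \<in> V" "open V" "V \<times> UNIV \<subseteq> ?W"
    using Elementary_Topology.tube_lemma[OF compact_UNIV, of ?W 0] by auto
  then have "cmod (g (x + v) - g x) < e" if "v \<in> V" for v x
    using that by (auto dest: subsetD[of _ _ "(v, x)"])
  then show ?thesis using \<open>open V\<close> \<open>0 \<in> V\<close> that by blast
qed

lemma continuous_if_uniform:
  fixes f :: "'a \<Rightarrow> complex"
  assumes "\<And>e. e > 0 \<Longrightarrow> \<exists>V. open V \<and> 0 \<in> V \<and> (\<forall>v\<in>V. \<forall>x. cmod (f (x + v) - f x) \<le> e)"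
  shows "continuous_on UNIV f"
proof -
  have "isCont f x" for x
    unfolding isCont_def
  proof (rule tendstoI)
    fix e :: real assume "e > 0"
    then obtain V where V: "open V" "0 \<in> V" "\<And>v x. v \<in> V \<Longrightarrow> cmod (f (x + v) - f x) \<le> e / 2"
      using assms[of "e / 2"] by auto
    have "open ((\<lambda>y. y - x) -` V)"
      using V(1) by (intro open_vimage continuous_intros)
    then have "\<forall>\<^sub>F y in at x. y \<in> (\<lambda>y. y - x) -` V"
      using V(2) by (intro eventually_at_in_open') auto
    then show "\<forall>\<^sub>F y in at x. dist (f y) (f x) < e"
    proof eventually_elim
      case (elim y)
      then show ?case using V(3)[of "y - x" x] \<open>e > 0\<close> by (simp add: dist_norm)
    qed
  qed
  then show ?thesis by (simp add: continuous_on_eq_continuous_at)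
qed

lemma finite_translate_cover:
  assumes "open (V :: 'a set)" "0 \<in> V"
  obtains Y where "finite Y" "\<And>x. \<exists>y\<in>Y. x - y \<in> V"
proof -
  have "open {x. x - y \<in> V}" for y
    using open_vimage[OF assms(1) continuous_on_translate(4)[OF continuous_on_id], of y]
    by (simp add: vimage_def)
  moreover have "UNIV \<subseteq> (\<Union>y. {x. x - y \<in> V})" 
  proof
    fix x show "x \<in> (\<Union>y. {x. x - y \<in> V})"
      using assms(2) by (intro UN_I[of x]) auto
  qed
  ultimately obtain Y where "finite Y" "UNIV \<subseteq> (\<Union>y\<in>Y. {x. x - y \<in> V})"
    using compactE_image[OF compact_UNIV, of UNIV "\<lambda>y. {x. x - y \<in> V}"] by metis
  then show ?thesis by (intro that[of Y]) auto
qed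

text \<open>
  Finitely many translates of a neighbourhood on which all functions vary by at most \<open>e / 4\<close> cover the group,
  so the uniform distance of two of the functions is controlled by their values at finitely many points.
\<close>

lemma Arzela_Ascoli_group:
  fixes u :: "nat \<Rightarrow> 'a \<Rightarrow> complex"
  assumes bounded: "\<And>n x. cmod (u n x) \<le> B"
    and equi: "\<And>e. e > 0 \<Longrightarrow> \<exists>V. open V \<and> 0 \<in> V \<and> (\<forall>n. \<forall>v\<in>V. \<forall>x. cmod (u n (x + v) - u n x) \<le> e)"
  obtains r l where "strict_mono (r :: nat \<Rightarrow> nat)" "uniform_limit UNIV (\<lambda>n. u (r n)) l sequentially"
    "continuous_on UNIV l"
proof -
  define d where "d = (\<lambda>m n. SUP x. cmod (u m x - u n x))"
  have bdd: "bdd_above (range (\<lambda>x. cmod (u m x - u n x)))" for m n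
  proof (rule bdd_aboveI2)
    show "cmod (u m x - u n x) \<le> 2 * B" for x
      using norm_triangle_ineq4[of "u m x" "u n x"] bounded[of m x] bounded[of n x] by linarith
  qed
  have "\<exists>r :: nat \<Rightarrow> nat. strict_mono r \<and> (\<forall>e>0. \<exists>N. \<forall>m\<ge>N. \<forall>n\<ge>N. d (r m) (r n) < e)"
  proof (rule Cauchy_subsequence_of_finite_coordinates[of UNIV u])
    show "\<exists>B. \<forall>n. cmod (u n x) \<le> B" for x using bounded by blast
    fix e :: real assume "e > 0"
    then obtain V where V: "open V" "0 \<in> V" "\<And>n v x. v \<in> V \<Longrightarrow> cmod (u n (x + v) - u n x) \<le> e / 4"
      using equi[of "e / 4"] by auto
    obtain Y where Y: "finite Y" "\<And>x. \<exists>y\<in>Y. x - y \<in> V"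
      using finite_translate_cover[OF V(1,2)] by blast
    have "d m n < e" if mn: "\<forall>y\<in>Y. cmod (u m y - u n y) < e / 4" for m n
    proof -
      have "cmod (u m x - u n x) \<le> 3 * e / 4" for x
      proof -
        obtain y where y: "y \<in> Y" "x - y \<in> V" using Y(2) by blast
        have "cmod (u k x - u k y) \<le> e / 4" for k
          using V(3)[OF y(2), of k y] by simp
        from this[of m] this[of n] mn y(1) show ?thesis
          using norm_triangle_ineq[of "u m x - u m y + (u m y - u n y)" "u n y - u n x"]
            norm_triangle_ineq[of "u m x - u m y" "u m y - u n y"] norm_minus_commute[of "u n y" "u n x"]
          by force
      qed
      then have "d m n \<le> 3 * e / 4"
        unfolding d_def by (intro cSUP_least) auto
      then show ?thesis using \<open>e > 0\<close> by simp
    qed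
    then show "\<exists>F \<delta>. finite F \<and> F \<subseteq> UNIV \<and> \<delta> > 0 \<and>
      (\<forall>m n. (\<forall>i\<in>F. cmod (u m i - u n i) < \<delta>) \<longrightarrow> d m n < e)"
      using Y(1) \<open>e > 0\<close> by (intro exI[of _ Y] exI[of _ "e / 4"]) auto
  qed
  then obtain r :: "nat \<Rightarrow> nat" where r: "strict_mono r"
    and rd: "\<And>e. e > 0 \<Longrightarrow> \<exists>N. \<forall>m\<ge>N. \<forall>n\<ge>N. d (r m) (r n) < e" by blast
  have "uniformly_Cauchy_on UNIV (\<lambda>n. u (r n))"
  proof (rule uniformly_Cauchy_onI)
    fix e :: real assume "e > 0"
    then obtain N where N: "\<And>m n. m \<ge> N \<Longrightarrow> n \<ge> N \<Longrightarrow> d (r m) (r n) < e"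
      using rd by blast
    have "dist (u (r m) x) (u (r n) x) < e" if "m \<ge> N" "n \<ge> N" for x m n
      unfolding dist_norm
      by (rule le_less_trans[OF cSUP_upper[OF _ bdd] N[OF that, unfolded d_def]]) simp
    then show "\<exists>M. \<forall>x\<in>UNIV. \<forall>m\<ge>M. \<forall>n\<ge>M. dist (u (r m) x) (u (r n) x) < e" by blast
  qed
  then obtain l where l: "uniform_limit UNIV (\<lambda>n. u (r n)) l sequentially"
    using Cauchy_uniformly_convergent unfolding uniformly_convergent_on_def by blast
  have "continuous_on UNIV (u n)" for n
    by (rule continuous_if_uniform) (meson equi)
  then have "continuous_on UNIV l"
    using uniform_limit_theorem[OF _ l] by simp
  with r l that show ?thesis by blast
qed

section \<open>Convolutions and autocorrelations\<close>

lemma convolution_integrable: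
  fixes g w :: "'a \<Rightarrow> complex"
  assumes "continuous_on UNIV g" "continuous_on UNIV w"
  shows "integrable \<mu> (\<lambda>y. g (x - y) * w y)"
  by (intro continuous_integrable continuous_on_mult continuous_on_translate(3)[OF assms(1)] assms(2))

text \<open>
  The measure has total mass 1, so the \<open>L\<^sup>1\<close> norm of \<open>w\<close> is at most its \<open>L\<^sup>2\<close> norm. Applied to \<open>g\<close> and to
  differences of translates of \<open>g\<close>, this bounds convolutions and their moduli of continuity.
\<close>

lemma norm_convolution_kernel_le:
  assumes "continuous_on UNIV k" "continuous_on UNIV w" "\<And>y. cmod (k y) \<le> e"
  shows "cmod (\<integral>y. k y * w y \<partial>\<mu>) \<le> e * L2_norm \<mu> w"
proof -
  have e: "0 \<le> e" using assms(3)[of 0] norm_ge_zero order_trans by blast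
  have "cmod (\<integral>y. k y * w y \<partial>\<mu>) \<le> (\<integral>y. cmod (k y * w y) \<partial>\<mu>)" by (rule integral_norm_bound)
  also have "\<dots> \<le> (\<integral>y. e * cmod (w y) \<partial>\<mu>)"
    using assms(3) by (intro integral_mono continuous_integrable continuous_intros assms(1,2))
      (simp add: norm_mult mult_right_mono)
  also have "\<dots> = e * (\<integral>y. cmod (w y) \<partial>\<mu>)" by simp
  also have "\<dots> \<le> e * L2_norm \<mu> w"
    using e by (intro mult_left_mono L1_norm_le_L2_norm continuous_L2 assms)
  finally show ?thesis .
qed

lemma norm_convolution_le:
  assumes "continuous_on UNIV g" "continuous_on UNIV w" "\<And>y. cmod (g y) \<le> B"
  shows "cmod (convolution \<mu> g w x) \<le> B * L2_norm \<mu> w"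
  unfolding convolution_def
  by (intro norm_convolution_kernel_le continuous_on_translate(3)[OF assms(1)] assms)

lemma convolution_modulus:
  assumes "continuous_on UNIV g" "continuous_on UNIV w" "\<And>x. cmod (g (x + v) - g x) \<le> e"
  shows "cmod (convolution \<mu> g w (x + v) - convolution \<mu> g w x) \<le> e * L2_norm \<mu> w"
proof -
  have "convolution \<mu> g w (x + v) - convolution \<mu> g w x
     = (\<integral>y. (g (x + v - y) - g (x - y)) * w y \<partial>\<mu>)"
    unfolding convolution_def
    by (simp add: left_diff_distrib convolution_integrable[OF assms(1,2)])
  also have "cmod \<dots> \<le> e * L2_norm \<mu> w"
  proof (intro norm_convolution_kernel_le continuous_on_diff continuous_on_translate(3)[OF assms(1)] assms(2))
    show "cmod (g (x + v - y) - g (x - y)) \<le> e" for y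
      using assms(3)[of "x - y"] by (simp add: algebra_simps)
  qed
  finally show ?thesis .
qed

lemma convolution_equicontinuous:
  assumes "continuous_on UNIV g" "e > 0"
  shows "\<exists>V. open V \<and> 0 \<in> V \<and> (\<forall>w. continuous_on UNIV w \<and> L2_norm \<mu> w \<le> b \<longrightarrow>
     (\<forall>v\<in>V. \<forall>x. cmod (convolution \<mu> g w (x + v) - convolution \<mu> g w x) \<le> e))"
proof -
  define c where "c = max b 1"
  have c: "c > 0" "b \<le> c" by (auto simp: c_def)
  obtain V where V: "open V" "0 \<in> V" "\<And>v x. v \<in> V \<Longrightarrow> cmod (g (x + v) - g x) < e / c"
    by (rule uniform_continuity[OF assms(1), of "e / c"]) (use c assms(2) in simp, rule that)
  have "cmod (convolution \<mu> g w (x + v) - convolution \<mu> g w x) \<le> e"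
    if "continuous_on UNIV w" "L2_norm \<mu> w \<le> b" "v \<in> V" for w v x
  proof -
    have "cmod (convolution \<mu> g w (x + v) - convolution \<mu> g w x) \<le> e / c * L2_norm \<mu> w"
      using V(3)[OF that(3)] by (intro convolution_modulus assms that(1)) (auto intro: less_imp_le)
    also have "\<dots> \<le> e / c * c"
      using that(2) c assms(2) by (intro mult_left_mono) auto
    finally show ?thesis using c by simp
  qed
  with V(1,2) show ?thesis by (intro exI[of _ V]) simp
qed

lemma continuous_convolution:
  assumes "continuous_on UNIV g" "continuous_on UNIV w"
  shows "continuous_on UNIV (convolution \<mu> g w)"
proof (rule continuous_if_uniform)
  fix e :: real assume "e > 0"
  then obtain V where "open V" "0 \<in> V" "\<forall>w'. continuous_on UNIV w' \<and> L2_norm \<mu> w' \<le> L2_norm \<mu> w \<longrightarrow>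
     (\<forall>v\<in>V. \<forall>x. cmod (convolution \<mu> g w' (x + v) - convolution \<mu> g w' x) \<le> e)"
    using convolution_equicontinuous[OF assms(1), of e "L2_norm \<mu> w"] by meson
  with assms(2)
  show "\<exists>V. open V \<and> 0 \<in> V \<and> (\<forall>v\<in>V. \<forall>x. cmod (convolution \<mu> g w (x + v) - convolution \<mu> g w x) \<le> e)"
    by (intro exI[of _ V]) simp
qed

lemma convolution_translate:
  assumes "continuous_on UNIV g" "continuous_on UNIV w"
  shows "convolution \<mu> g (\<lambda>y. w (y + a)) x = convolution \<mu> g w (x + a)"
proof -
  have "continuous_on UNIV (\<lambda>y. g (x + a - y) * w y)"
    by (intro continuous_on_mult continuous_on_translate(3)[OF assms(1)] assms(2))
  from continuous_translation_invariant[OF this, of a] show ?thesis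
    by (simp add: convolution_def algebra_simps)
qed

lemma convolution_add:
  assumes "continuous_on UNIV g" "continuous_on UNIV w" "continuous_on UNIV w'"
  shows "convolution \<mu> g (\<lambda>y. w y + w' y) x = convolution \<mu> g w x + convolution \<mu> g w' x"
  using convolution_integrable assms by (simp add: convolution_def distrib_left)

lemma convolution_scale: "convolution \<mu> g (\<lambda>y. c * w y) x = c * convolution \<mu> g w x"
  by (simp add: convolution_def mult.left_commute[of _ c])

lemma autocorrelation_integrable:
  assumes "continuous_on UNIV u" "continuous_on UNIV v"
  shows "integrable \<mu> (\<lambda>z. u (x + z) * cnj (v z))"
  by (intro continuous_integrable continuous_intros continuous_on_translate(2)[OF assms(1)] assms(2))

lemma autocorrelation_zero: "autocorrelation \<mu> u 0 = of_real ((L2_norm \<mu> u)\<^sup>2)"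
  by (simp add: autocorrelation_def L2_norm_square complex_norm_square[symmetric] flip: of_real_power)

lemma autocorrelation_scale: "autocorrelation \<mu> (\<lambda>x. c * u x) x = of_real ((cmod c)\<^sup>2) * autocorrelation \<mu> u x"
proof -
  have "autocorrelation \<mu> (\<lambda>x. c * u x) x = (\<integral>z. (c * cnj c) * (u (x + z) * cnj (u z)) \<partial>\<mu>)"
    unfolding autocorrelation_def by (simp add: mult_ac)
  then show ?thesis
    by (simp only: complex_norm_square Bochner_Integration.integral_mult_right_zero) (simp add: autocorrelation_def)
qed

lemma norm_autocorrelation_le:
  assumes "continuous_on UNIV u" "\<And>x. cmod (u x) \<le> B"
  shows "cmod (autocorrelation \<mu> u x) \<le> B\<^sup>2"
  unfolding autocorrelation_def power2_eq_square
  by (intro integral_norm_le continuous_intros continuous_on_translate(2)[OF assms(1)] assms(1))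
    (auto simp: norm_mult intro!: mult_mono assms order_trans[OF norm_ge_zero assms(2)])

lemma autocorrelation_perturb:
  assumes "continuous_on UNIV u" "continuous_on UNIV v"
    and "\<And>x. cmod (u x) \<le> B" "\<And>x. cmod (v x) \<le> B" "\<And>x. cmod (u x - v x) \<le> e"
  shows "cmod (autocorrelation \<mu> u x - autocorrelation \<mu> v x) \<le> 2 * B * e"
proof -
  have B: "B \<ge> 0" "e \<ge> 0" using norm_ge_zero assms(3,5) order_trans by blast+
  have "autocorrelation \<mu> u x - autocorrelation \<mu> v x
    = (\<integral>z. (u (x + z) - v (x + z)) * cnj (u z) + v (x + z) * cnj (u z - v z) \<partial>\<mu>)"
    unfolding autocorrelation_def
    using autocorrelation_integrable[OF assms(1,1)] autocorrelation_integrable[OF assms(2,2)]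
    by (subst Bochner_Integration.integral_diff[symmetric]) (auto simp: left_diff_distrib right_diff_distrib)
  also have "cmod \<dots> \<le> 2 * B * e"
  proof (intro integral_norm_le continuous_intros continuous_on_translate(2)[OF assms(1)]
      continuous_on_translate(2)[OF assms(2)] assms(1,2))
    fix z
    have "cmod ((u (x + z) - v (x + z)) * cnj (u z) + v (x + z) * cnj (u z - v z))
      \<le> cmod ((u (x + z) - v (x + z)) * cnj (u z)) + cmod (v (x + z) * cnj (u z - v z))"
      by (rule norm_triangle_ineq)
    also have "\<dots> \<le> e * B + B * e"
      unfolding norm_mult complex_mod_cnj by (intro add_mono mult_mono assms norm_ge_zero B)
    finally show "cmod ((u (x + z) - v (x + z)) * cnj (u z) + v (x + z) * cnj (u z - v z)) \<le> 2 * B * e"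
      by simp
  qed
  finally show ?thesis .
qed

lemma continuous_autocorrelation:
  assumes "continuous_on UNIV u"
  shows "continuous_on UNIV (autocorrelation \<mu> u)"
proof (rule continuous_if_uniform)
  fix e :: real assume e: "e > 0"
  obtain B where B: "B > 0" "\<And>x. cmod (u x) \<le> B" using continuous_bounded[OF assms] by blast
  obtain V where V: "open V" "0 \<in> V" "\<And>v x. v \<in> V \<Longrightarrow> cmod (u (x + v) - u x) < e / B"
    by (rule uniform_continuity[OF assms, of "e / B"]) (use B e in simp, rule that)
  have "cmod (autocorrelation \<mu> u (x + v) - autocorrelation \<mu> u x) \<le> e" if "v \<in> V" for v x
  proof -
    have "autocorrelation \<mu> u (x + v) - autocorrelation \<mu> u x
      = (\<integral>z. (u (x + v + z) - u (x + z)) * cnj (u z) \<partial>\<mu>)"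
      unfolding autocorrelation_def using autocorrelation_integrable[OF assms assms]
      by (simp add: left_diff_distrib)
    also have "cmod \<dots> \<le> e / B * B"
    proof (intro integral_norm_le continuous_intros continuous_on_translate(2)[OF assms] assms)
      fix z
      have "cmod (u (x + v + z) - u (x + z)) \<le> e / B"
        using V(3)[OF that, of "x + z"] by (simp add: algebra_simps)
      then show "cmod ((u (x + v + z) - u (x + z)) * cnj (u z)) \<le> e / B * B"
        unfolding norm_mult complex_mod_cnj using B e by (intro mult_mono) auto
    qed
    finally show ?thesis using B by simp
  qed
  with V(1,2) show "\<exists>V. open V \<and> 0 \<in> V \<and>
      (\<forall>v\<in>V. \<forall>x. cmod (autocorrelation \<mu> u (x + v) - autocorrelation \<mu> u x) \<le> e)"
    by blast
qed

text \<open>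
  Expand the product: the two diagonal terms agree by translation invariance, and the mixed terms are
  translates of the autocorrelation. Adding the identities for \<open>c\<close> and \<open>- c\<close> leaves four times the autocorrelation.
\<close>

lemma autocorrelation_add_translate:
  assumes u: "continuous_on UNIV u" and c: "cmod c = 1"
  shows "autocorrelation \<mu> (\<lambda>x. u x + c * u (x + a)) x =
    2 * autocorrelation \<mu> u x + c * autocorrelation \<mu> u (x + a) + cnj c * autocorrelation \<mu> u (x - a)"
proof -
  have c1: "c * cnj c = 1" using c by (simp add: complex_norm_square[symmetric])
  have "autocorrelation \<mu> (\<lambda>x. u x + c * u (x + a)) x =
    (\<integral>z. u (x + z) * cnj (u z) + u (x + (z + a)) * cnj (u (z + a))
        + c * (u (x + a + z) * cnj (u z)) + cnj c * (u (x - a + (z + a)) * cnj (u (z + a))) \<partial>\<mu>)"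
    unfolding autocorrelation_def
  proof (rule Bochner_Integration.integral_cong[OF refl])
    fix z
    have "c * u (x + z + a) * (cnj c * cnj (u (z + a))) = (c * cnj c) * (u (x + (z + a)) * cnj (u (z + a)))"
      by (simp add: algebra_simps)
    then show "(u (x + z) + c * u (x + z + a)) * cnj (u z + c * u (z + a)) =
      u (x + z) * cnj (u z) + u (x + (z + a)) * cnj (u (z + a))
        + c * (u (x + a + z) * cnj (u z)) + cnj c * (u (x - a + (z + a)) * cnj (u (z + a)))"
      unfolding c1 by (simp add: algebra_simps)
  qed
  also have "\<dots> = (\<integral>z. u (x + z) * cnj (u z) \<partial>\<mu>) + (\<integral>z. u (x + (z + a)) * cnj (u (z + a)) \<partial>\<mu>)
        + c * (\<integral>z. u (x + a + z) * cnj (u z) \<partial>\<mu>)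
        + cnj c * (\<integral>z. u (x - a + (z + a)) * cnj (u (z + a)) \<partial>\<mu>)"
  proof -
    have i: "integrable \<mu> (\<lambda>z. u (y + z) * cnj (u z))" for y
      by (rule autocorrelation_integrable[OF u u])
    have j: "integrable \<mu> (\<lambda>z. u (y + (z + a)) * cnj (u (z + a)))" for y
      using autocorrelation_integrable[OF continuous_on_translate(1)[OF u] continuous_on_translate(1)[OF u], of y a a]
      by (simp add: add.assoc)
    show ?thesis
      by (simp only: Bochner_Integration.integral_add Bochner_Integration.integrable_add
          Bochner_Integration.integrable_mult_right i j Bochner_Integration.integral_mult_right_zero)
  qed
  also have "\<dots> = 2 * autocorrelation \<mu> u x + c * autocorrelation \<mu> u (x + a)
      + cnj c * autocorrelation \<mu> u (x - a)"
  proof -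
    have "(\<integral>z. u (y + (z + a)) * cnj (u (z + a)) \<partial>\<mu>) = autocorrelation \<mu> u y" for y
      unfolding autocorrelation_def
      by (rule continuous_translation_invariant[of "\<lambda>z. u (y + z) * cnj (u z)"])
        (intro continuous_intros continuous_on_translate(2)[OF u] u)
    then show ?thesis
      by (simp only: autocorrelation_def[symmetric]) simp
  qed
  finally show ?thesis .
qed

lemma L2_norm_uniform_limit:
  assumes v: "\<And>n. continuous_on UNIV (v n)" and l: "continuous_on UNIV l"
    and lim: "uniform_limit UNIV v l sequentially"
  shows "(\<lambda>n. L2_norm \<mu> (v n)) \<longlonglongrightarrow> L2_norm \<mu> l"
proof (rule LIMSEQ_I)
  fix e :: real assume e: "e > 0"
  from uniform_limitD[OF lim, of "e / 2"] e obtain N where N: "\<And>n x. n \<ge> N \<Longrightarrow> dist (v n x) (l x) < e / 2"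
    by (auto simp: eventually_sequentially)
  have "norm (L2_norm \<mu> (v n) - L2_norm \<mu> l) < e" if "n \<ge> N" for n
  proof -
    have "L2_norm \<mu> (\<lambda>x. v n x - l x) \<le> e / 2"
      using N[OF that] e by (intro L2_norm_le_sup continuous_intros v l) (auto simp: dist_norm intro: less_imp_le)
    moreover have "L2_norm \<mu> (v n) \<le> L2_norm \<mu> (\<lambda>x. v n x - l x) + L2_norm \<mu> l"
      using L2_norm_triangle[of "\<lambda>x. v n x - l x" \<mu> l] by (simp add: continuous_L2 L2_diff v l)
    moreover have "L2_norm \<mu> l \<le> L2_norm \<mu> (\<lambda>x. l x - v n x) + L2_norm \<mu> (v n)"
      using L2_norm_triangle[of "\<lambda>x. l x - v n x" \<mu> "v n"] by (simp add: continuous_L2 L2_diff v l)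
    ultimately show ?thesis
      using e L2_norm_minus_commute[of \<mu> l "v n"] by (simp add: abs_less_iff)
  qed
  then show "\<exists>N. \<forall>n\<ge>N. norm (L2_norm \<mu> (v n) - L2_norm \<mu> l) < e" by blast
qed

lemma autocorrelation_uniform_limit:
  assumes v: "\<And>n. continuous_on UNIV (v n)" and l: "continuous_on UNIV l"
    and lim: "uniform_limit UNIV v l sequentially"
  shows "uniform_limit UNIV (\<lambda>n. autocorrelation \<mu> (v n)) (autocorrelation \<mu> l) sequentially"
proof (rule uniform_limitI)
  fix e :: real assume e: "e > 0"
  obtain B where B: "B > 0" "\<And>x. cmod (l x) \<le> B" using continuous_bounded[OF l] by blast
  (* The first bound gives B + 1 as a common bound for l and v n, the second makes the error e / 2. *)
  define \<delta> where "\<delta> = min 1 (e / (4 * (B + 1)))"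
  have \<delta>: "\<delta> > 0" "\<delta> \<le> 1" "\<delta> \<le> e / (4 * (B + 1))" using B e by (auto simp: \<delta>_def)
  from uniform_limitD[OF lim \<delta>(1)]
  show "\<forall>\<^sub>F n in sequentially. \<forall>x\<in>UNIV. dist (autocorrelation \<mu> (v n) x) (autocorrelation \<mu> l x) < e"
  proof eventually_elim
    case (elim n)
    have d: "cmod (v n x - l x) \<le> \<delta>" for x using elim by (auto simp: dist_norm intro: less_imp_le)
    have v1: "cmod (v n x) \<le> B + 1" for x
      using norm_triangle_sub[of "v n x" "l x"] d[of x] B(2)[of x] \<delta> by linarith
    have "cmod (autocorrelation \<mu> (v n) x - autocorrelation \<mu> l x) \<le> 2 * (B + 1) * \<delta>" for x
      using B(2) by (intro autocorrelation_perturb v l v1 d) (simp add: add_increasing2)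
    moreover have "2 * (B + 1) * \<delta> < e"
    proof -
      have "2 * (B + 1) * \<delta> \<le> 2 * (B + 1) * (e / (4 * (B + 1)))"
        using \<delta> B by (intro mult_left_mono) auto
      also have "\<dots> = e / 2" using B by (simp add: field_simps)
      finally show ?thesis using e by simp
    qed
    ultimately show ?case by (auto simp: dist_norm intro: le_less_trans)
  qed
qed

section \<open>Every nonzero continuous function correlates with a character\<close>

text \<open>
  The eigenvalues \<open>k a\<close> are multiplicative in \<open>a\<close>. Comparing with a point where \<open>\<bar>\<psi>\<bar>\<close> is maximal gives \<open>\<bar>k a\<bar> \<le> 1\<close>, and
  the same for \<open>- a\<close> gives equality.
\<close>

lemma character_of_translation_eigenfunction:
  fixes \<psi> :: "'a \<Rightarrow> complex"
  assumes cont: "continuous_on UNIV \<psi>" and nz: "\<psi> y \<noteq> 0"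
    and eigen: "\<And>a. \<exists>k. \<forall>x. \<psi> (x + a) = k * \<psi> x"
  shows "\<psi> 0 \<noteq> 0" "(\<lambda>a. \<psi> a / \<psi> 0) \<in> dual_group"
proof -
  obtain k where k: "\<And>a x. \<psi> (x + a) = k a * \<psi> x" using eigen by metis
  show 0: "\<psi> 0 \<noteq> 0" using k[of 0 y] nz by auto
  have k_eq: "k a = \<psi> a / \<psi> 0" for a
    using k[of 0 a] 0 by simp
  have le1: "cmod (k a) \<le> 1" for a
  proof -
    obtain x where x: "\<And>z. cmod (\<psi> z) \<le> cmod (\<psi> x)"
      using continuous_attains_sup[OF compact_UNIV, of "\<lambda>x. cmod (\<psi> x)"] cont
      by (auto intro: continuous_on_norm)
    have "cmod (\<psi> x) > 0" using x[of y] nz by (smt (verit) zero_less_norm_iff)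
    moreover have "cmod (k a) * cmod (\<psi> x) \<le> 1 * cmod (\<psi> x)"
      using x[of "x + a"] k[of x a] by (simp add: norm_mult)
    ultimately show ?thesis by (metis mult_le_cancel_right_pos)
  qed
  have hom: "k (a + b) = k a * k b" for a b
    using k[of a b] 0 unfolding k_eq by simp
  have k0: "k 0 = 1" using 0 by (simp add: k_eq)
  have "cmod (k a) = 1" for a
  proof -
    have "k a * k (- a) = 1" using hom[of a "- a"] k0 by simp
    then have "cmod (k a) * cmod (k (- a)) = 1" by (metis norm_mult norm_one)
    then show ?thesis
      using le1[of a] le1[of "- a"] by (smt (verit) mult_left_le norm_ge_zero mult_le_one)
  qed
  then show "(\<lambda>a. \<psi> a / \<psi> 0) \<in> dual_group"
    using hom 0 unfolding dual_group_def k_eq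
    by (auto intro!: continuous_intros cont)
qed

lemma L2_norm_translate:
  assumes "continuous_on UNIV f"
  shows "L2_norm \<mu> (\<lambda>x. f (x + a)) = L2_norm \<mu> f"
proof -
  have "(\<integral>x. (cmod (f (x + a)))\<^sup>2 \<partial>\<mu>) = (\<integral>x. (cmod (f x))\<^sup>2 \<partial>\<mu>)"
  proof -
    have "(\<integral>x. complex_of_real ((cmod (f (x + a)))\<^sup>2) \<partial>\<mu>) = (\<integral>x. complex_of_real ((cmod (f x))\<^sup>2) \<partial>\<mu>)"
      by (rule continuous_translation_invariant[of "\<lambda>x. complex_of_real ((cmod (f x))\<^sup>2)"])
        (intro continuous_intros assms)
    then show ?thesis by (simp only: integral_complex_of_real of_real_eq_iff)
  qed
  then show ?thesis by (simp add: L2_norm_def)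
qed

text \<open>
  Existence for the extremal problem: a maximizing sequence of weights need not converge, but by equicontinuity
  its convolutions with \<open>g\<close> do along a subsequence. The bound with \<open>s\<close> for weights of arbitrary norm follows by homogeneity,
  as the autocorrelation is quadratic. The supremum is positive because the weight \<open>w(y) = cnj (g(- y))\<close> gives
  \<open>(g * w)(0) = \<parallel>w\<parallel>\<^sup>2 \<noteq> 0\<close>.
\<close>

lemma exists_extremal_convolution:
  assumes g: "continuous_on UNIV g" and nz: "g y \<noteq> 0"
  obtains s w u where "s > 0"
    "\<And>w. continuous_on UNIV w \<Longrightarrow> L2_norm \<mu> (autocorrelation \<mu> (convolution \<mu> g w)) \<le> s * (L2_norm \<mu> w)\<^sup>2"
    "\<And>n. continuous_on UNIV (w n)" "\<And>n::nat. L2_norm \<mu> (w n) \<le> 1"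
    "continuous_on UNIV u" "uniform_limit UNIV (\<lambda>n. convolution \<mu> g (w n)) u sequentially"
    "L2_norm \<mu> (autocorrelation \<mu> u) = s"
proof -
  let ?N = "\<lambda>w. L2_norm \<mu> (autocorrelation \<mu> (convolution \<mu> g w))"
  note cc = continuous_convolution[OF g] and ca = continuous_autocorrelation
  obtain B where B: "B > 0" "\<And>x. cmod (g x) \<le> B" using continuous_bounded[OF g] by blast
  define W where "W = {w. continuous_on UNIV w \<and> L2_norm \<mu> w \<le> 1}"
  have conv_le: "cmod (convolution \<mu> g w x) \<le> B" if "w \<in> W" for w x
  proof -
    have "cmod (convolution \<mu> g w x) \<le> B * L2_norm \<mu> w"
      using that B by (intro norm_convolution_le g) (auto simp: W_def)
    also have "\<dots> \<le> B * 1" using that B by (intro mult_left_mono) (auto simp: W_def)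
    finally show ?thesis by simp
  qed
  have N_le: "?N w \<le> B\<^sup>2" if "w \<in> W" for w
    using that conv_le[OF that]
    by (intro L2_norm_le_sup ca cc norm_autocorrelation_le) (auto simp: W_def)
  define s where "s = (SUP w\<in>W. ?N w)"
  have bdd: "bdd_above (?N ` W)" using N_le by (intro bdd_aboveI2)
  have W0: "(\<lambda>_. 0) \<in> W" by (simp add: W_def L2_norm_def)
  have s_upper: "?N w \<le> s" if "w \<in> W" for w
    unfolding s_def by (rule cSUP_upper[OF that bdd])
  have s_bound: "?N w \<le> s * (L2_norm \<mu> w)\<^sup>2" if w: "continuous_on UNIV w" for w
  proof (cases "L2_norm \<mu> w = 0")
    case True
    then have "w x = 0" for x using L2_norm_eq_0_imp[OF w] by blast
    then show ?thesis by (simp add: True convolution_def autocorrelation_def L2_norm_def)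
  next
    case False
    define b where "b = L2_norm \<mu> w"
    have b: "b > 0" using False unfolding b_def by (simp add: less_le)
    define v where "v = (\<lambda>x. complex_of_real (1 / b) * w x)"
    have "L2_norm \<mu> v = cmod (complex_of_real (1 / b)) * b"
      unfolding v_def b_def by (rule L2_norm_scale)
    then have "v \<in> W" using b w unfolding W_def v_def
      by (auto intro!: continuous_intros simp: norm_divide)
    then have "?N v \<le> s" by (rule s_upper)
    moreover have "w = (\<lambda>x. complex_of_real b * v x)" using b by (simp add: v_def)
    then have "?N w = ?N (\<lambda>x. complex_of_real b * v x)" by simp
    moreover have "\<dots> = b\<^sup>2 * ?N v"
    proof -
      have "convolution \<mu> g (\<lambda>x. complex_of_real b * v x) = (\<lambda>x. complex_of_real b * convolution \<mu> g v x)"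
        by (rule ext) (rule convolution_scale)
      moreover have "autocorrelation \<mu> (\<lambda>x. complex_of_real b * convolution \<mu> g v x)
        = (\<lambda>x. complex_of_real (b\<^sup>2) * autocorrelation \<mu> (convolution \<mu> g v) x)"
        using b by (intro ext) (simp only: autocorrelation_scale norm_of_real abs_of_pos)
      ultimately show ?thesis by (simp add: L2_norm_scale norm_power del: of_real_power)
    qed
    ultimately show ?thesis using b by (simp add: b_def[symmetric] mult.commute[of s])
  qed
  have s_pos: "s > 0"
  proof (rule ccontr)
    assume "\<not> s > 0"
    then have s_le: "s \<le> 0" by simp
    define w where "w = (\<lambda>y. cnj (g (- y)))"
    have w: "continuous_on UNIV w"
      unfolding w_def by (intro continuous_intros continuous_on_translate(5)[OF g])
    have "?N w \<le> 0"
      using s_bound[OF w] s_le mult_nonpos_nonneg[of s "(L2_norm \<mu> w)\<^sup>2"] by simp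
    then have "?N w = 0" using L2_norm_nonneg[of \<mu>] by (simp add: antisym)
    then have "autocorrelation \<mu> (convolution \<mu> g w) 0 = 0"
      by (rule L2_norm_eq_0_imp[OF ca[OF cc[OF w]]])
    then have "L2_norm \<mu> (convolution \<mu> g w) = 0"
      by (simp add: autocorrelation_zero)
    then have "convolution \<mu> g w 0 = 0"
      by (rule L2_norm_eq_0_imp[OF cc[OF w]])
    then have "complex_of_real (\<integral>y. (cmod (w y))\<^sup>2 \<partial>\<mu>) = 0"
      unfolding convolution_def w_def
      by (simp only: integral_complex_of_real[symmetric] complex_norm_square complex_cnj_cnj
          diff_0 mult.commute)
    then have "L2_norm \<mu> w = 0" by (simp add: L2_norm_def)
    then have "w (- y) = 0" by (rule L2_norm_eq_0_imp[OF w])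
    then show False using nz by (simp add: w_def)
  qed
  have "\<exists>w\<in>W. s - 1 / real (Suc n) < ?N w" for n
    using less_cSUP_iff[OF _ bdd, of "s - 1 / real (Suc n)"] W0 unfolding s_def[symmetric] by auto
  then obtain w where w: "\<And>n. w n \<in> W" "\<And>n. s - 1 / real (Suc n) < ?N (w n)" by metis
  have wc: "continuous_on UNIV (w n)" "L2_norm \<mu> (w n) \<le> 1" for n using w(1) by (auto simp: W_def)
  have "\<exists>V. open V \<and> 0 \<in> V \<and> (\<forall>n. \<forall>v\<in>V. \<forall>x.
      cmod (convolution \<mu> g (w n) (x + v) - convolution \<mu> g (w n) x) \<le> e)" if e: "e > 0" for e
  proof -
    obtain V where V: "open V" "0 \<in> V" "\<forall>w'. continuous_on UNIV w' \<and> L2_norm \<mu> w' \<le> 1 \<longrightarrow>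
     (\<forall>v\<in>V. \<forall>x. cmod (convolution \<mu> g w' (x + v) - convolution \<mu> g w' x) \<le> e)"
      using convolution_equicontinuous[OF g e, of 1] by meson
    with wc show ?thesis by (intro exI[of _ V]) simp
  qed
  from Arzela_Ascoli_group[of "\<lambda>n. convolution \<mu> g (w n)", OF conv_le[OF w(1)] this]
  obtain r u where r: "strict_mono (r :: nat \<Rightarrow> nat)"
    and u: "uniform_limit UNIV (\<lambda>n. convolution \<mu> g (w (r n))) u sequentially" "continuous_on UNIV u"
    by blast
  have lim: "(\<lambda>n. ?N (w (r n))) \<longlonglongrightarrow> L2_norm \<mu> (autocorrelation \<mu> u)"
    by (intro L2_norm_uniform_limit autocorrelation_uniform_limit ca cc u wc)
  have "(\<lambda>n. ?N (w (r n))) \<longlonglongrightarrow> s"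
  proof (rule tendsto_sandwich)
    have "(\<lambda>n. 1 / real (Suc (r n))) \<longlonglongrightarrow> 0"
      using LIMSEQ_subseq_LIMSEQ[OF LIMSEQ_Suc[OF lim_1_over_n] r] by (simp add: o_def)
    then show "(\<lambda>n. s - 1 / real (Suc (r n))) \<longlonglongrightarrow> s"
      using tendsto_diff[OF tendsto_const] by fastforce
    show "\<forall>\<^sub>F n in sequentially. s - 1 / real (Suc (r n)) \<le> ?N (w (r n))"
      using w(2) by (simp add: less_imp_le)
    show "\<forall>\<^sub>F n in sequentially. ?N (w (r n)) \<le> s"
      using s_upper[OF w(1)] by simp
  qed simp
  with lim have "L2_norm \<mu> (autocorrelation \<mu> u) = s" by (rule LIMSEQ_unique)
  then show ?thesis
    using that[of s "\<lambda>n. w (r n)" u] s_pos s_bound wc u by blast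
qed

text \<open>
  The heart of the proof. The perturbations of \<open>u\<close> by \<open>c\<close> and by \<open>- c\<close> times a translate have autocorrelations with sum
  \<open>4 \<psi>\<close>, while maximality and the parallelogram law bound the sum of their norms by \<open>4 s = \<parallel>4 \<psi>\<parallel>\<close>. Equality in
  the triangle inequality makes both proportional to \<open>\<psi>\<close>.
\<close>

lemma extremal_eigenfunction:
  assumes g: "continuous_on UNIV g" and s: "s > 0"
    and s_bound: "\<And>w. continuous_on UNIV w \<Longrightarrow>
      L2_norm \<mu> (autocorrelation \<mu> (convolution \<mu> g w)) \<le> s * (L2_norm \<mu> w)\<^sup>2"
    and w: "\<And>n. continuous_on UNIV (w n)" "\<And>n::nat. L2_norm \<mu> (w n) \<le> 1"
    and u: "continuous_on UNIV u"
    and lim: "uniform_limit UNIV (\<lambda>n. convolution \<mu> g (w n)) u sequentially"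
    and attained: "L2_norm \<mu> (autocorrelation \<mu> u) = s"
  shows "\<exists>k. \<forall>x. autocorrelation \<mu> u (x + a) = k * autocorrelation \<mu> u x"
proof -
  define \<psi> where "\<psi> = autocorrelation \<mu> u"
  note cc = continuous_convolution[OF g] and ca = continuous_autocorrelation
  have c\<psi>: "continuous_on UNIV \<psi>" unfolding \<psi>_def by (rule ca[OF u])
  have rel: "\<exists>\<rho>. \<forall>x. c * \<psi> (x + a) + cnj c * \<psi> (x - a) = \<rho> * \<psi> x" if c: "cmod c = 1" for c
  proof -
    define A where "A = (\<lambda>c. autocorrelation \<mu> (\<lambda>x. u x + c * u (x + a)))"
    have A_eq: "A c x = 2 * \<psi> x + (c * \<psi> (x + a) + cnj c * \<psi> (x - a))" if "cmod c = 1" for c x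
      using autocorrelation_add_translate[OF u that] by (simp add: A_def \<psi>_def add.assoc)
    have shift: "continuous_on UNIV (\<lambda>x. f x + c * f (x + a))" if "continuous_on UNIV f" for f :: "'a \<Rightarrow> complex" and c
      by (intro continuous_intros that continuous_on_translate(1)[OF that])
    have cA: "continuous_on UNIV (A c)" for c unfolding A_def by (intro ca shift u)
    have conv_shift: "convolution \<mu> g (\<lambda>y. w n y + c * w n (y + a))
        = (\<lambda>x. convolution \<mu> g (w n) x + c * convolution \<mu> g (w n) (x + a))" for n c
      using w(1)[of n]
      by (intro ext) (simp add: convolution_add convolution_scale convolution_translate g
          continuous_on_translate continuous_on_mult_left)
    have limA: "(\<lambda>n. L2_norm \<mu> (autocorrelation \<mu> (convolution \<mu> g (\<lambda>y. w n y + c * w n (y + a)))))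
        \<longlonglongrightarrow> L2_norm \<mu> (A c)" for c
      unfolding A_def
    proof (intro L2_norm_uniform_limit autocorrelation_uniform_limit ca cc shift w u)
      have "uniform_limit UNIV (\<lambda>n x. convolution \<mu> g (w n) (x + a)) (\<lambda>x. u (x + a)) sequentially"
        using uniform_limit_compose'[OF lim, of "\<lambda>x. x + a" UNIV] by simp
      from bounded_linear.uniform_limit[OF bounded_linear_mult_right this, of c]
      show "uniform_limit UNIV (\<lambda>n. convolution \<mu> g (\<lambda>y. w n y + c * w n (y + a)))
          (\<lambda>x. u x + c * u (x + a)) sequentially"
        unfolding conv_shift
        by (intro uniform_limit_add lim)
    qed
    (* Maximality holds for the convolutions with weights, not for u itself, so the bound is
       proved along the sequence and passed to the limit. *)
    have sum_le: "L2_norm \<mu> (A c) + L2_norm \<mu> (A (- c)) \<le> 4 * s"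
    proof (rule LIMSEQ_le_const2[OF tendsto_add[OF limA limA]], intro exI allI impI)
      fix n
      define v where "v = (\<lambda>y. c * w n (y + a))"
      have v: "continuous_on UNIV v"
        unfolding v_def by (intro continuous_intros continuous_on_translate(1)[OF w(1)])
      have Nv: "L2_norm \<mu> v = L2_norm \<mu> (w n)"
        unfolding v_def L2_norm_scale using c L2_norm_translate[OF w(1)] by simp
      have "L2_norm \<mu> (autocorrelation \<mu> (convolution \<mu> g (\<lambda>y. w n y + v y)))
          + L2_norm \<mu> (autocorrelation \<mu> (convolution \<mu> g (\<lambda>y. w n y - v y)))
        \<le> s * (L2_norm \<mu> (\<lambda>y. w n y + v y))\<^sup>2 + s * (L2_norm \<mu> (\<lambda>y. w n y - v y))\<^sup>2"
        by (intro add_mono s_bound continuous_on_add continuous_on_diff v w)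
      also have "\<dots> = s * (4 * (L2_norm \<mu> (w n))\<^sup>2)"
        using L2_parallelogram[OF continuous_L2[OF w(1)] continuous_L2[OF v], of n]
        by (simp add: Nv flip: distrib_left)
      also have "\<dots> \<le> s * (4 * 1)"
        using s w(2)[of n] by (intro mult_left_mono) (auto intro: power_le_one)
      finally show "L2_norm \<mu> (autocorrelation \<mu> (convolution \<mu> g (\<lambda>y. w n y + c * w n (y + a))))
          + L2_norm \<mu> (autocorrelation \<mu> (convolution \<mu> g (\<lambda>y. w n y + - c * w n (y + a)))) \<le> 4 * s"
        by (simp add: v_def)
    qed
    let ?\<alpha> = "L2_norm \<mu> (A c)" and ?\<beta> = "L2_norm \<mu> (A (- c))"
    have A_sum: "A c x + A (- c) x = 4 * \<psi> x" for x
      using c by (simp add: A_eq)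
    have "L2_norm \<mu> (\<lambda>x. A c x + A (- c) x) = 4 * s"
      unfolding A_sum L2_norm_scale using attained by (simp add: \<psi>_def)
    then have eq4: "?\<alpha> + ?\<beta> = 4 * s" and
      par0: "L2_norm \<mu> (\<lambda>x. of_real ?\<beta> * A c x - of_real ?\<alpha> * A (- c) x) = 0"
      using sum_le L2_norm_triangle[OF continuous_L2 continuous_L2, OF cA cA, of c "- c"]
        L2_norm_triangle_equality[OF continuous_L2 continuous_L2, OF cA cA, of c "- c"] by auto
    (* Adding ?\<alpha> * A c x on both sides of the proportionality turns A (- c) x into 4 * \<psi> x. *)
    have "A c x = of_real (?\<alpha> / s) * \<psi> x" for x
    proof -
      have "of_real ?\<beta> * A c x - of_real ?\<alpha> * A (- c) x = 0"
        by (rule L2_norm_eq_0_imp[OF _ par0]) (intro continuous_intros cA)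
      then have "of_real (?\<alpha> + ?\<beta>) * A c x = of_real ?\<alpha> * (A c x + A (- c) x)"
        by (simp add: algebra_simps)
      then have "of_real (4 * s) * A c x = of_real ?\<alpha> * (4 * \<psi> x)"
        unfolding eq4 A_sum .
      then show ?thesis using s by (simp add: field_simps)
    qed
    then have "c * \<psi> (x + a) + cnj c * \<psi> (x - a) = (of_real (?\<alpha> / s) - 2) * \<psi> x" for x
      using A_eq[OF c, of x] by (simp add: algebra_simps)
    then show ?thesis by blast
  qed
  obtain \<rho>1 where \<rho>1: "\<And>x. \<psi> (x + a) + \<psi> (x - a) = \<rho>1 * \<psi> x"
    using rel[of 1] by auto
  obtain \<rho>2 where \<rho>2: "\<And>x. \<i> * \<psi> (x + a) - \<i> * \<psi> (x - a) = \<rho>2 * \<psi> x"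
    using rel[of \<i>] by auto
  have "\<psi> (x + a) = ((\<rho>1 - \<i> * \<rho>2) / 2) * \<psi> x" for x
  proof -
    have "(\<rho>1 - \<i> * \<rho>2) * \<psi> x = (\<rho>1 * \<psi> x) - \<i> * (\<rho>2 * \<psi> x)" by (simp add: algebra_simps)
    also have "\<dots> = 2 * \<psi> (x + a)"
      unfolding \<rho>1[symmetric] \<rho>2[symmetric] by (simp add: algebra_simps)
    finally show ?thesis by simp
  qed
  then show ?thesis unfolding \<psi>_def by blast
qed

text \<open>
  The squared distance of the two sides, expanded, consists of values of the autocorrelation at \<open>0\<close> and \<open>a\<close>,
  and these cancel.
\<close>

lemma translation_by_autocorrelation_character:
  assumes u: "continuous_on UNIV u" and \<xi>: "\<xi> \<in> dual_group"
    and ac: "\<And>x. autocorrelation \<mu> u x = autocorrelation \<mu> u 0 * \<xi> x"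
  shows "u (x + a) = \<xi> a * u x"
proof -
  have c1: "cmod (\<xi> a) = 1" using \<xi> by (rule dual_groupD)
  have cu: "continuous_on UNIV (\<lambda>x. u (x + a))" by (rule continuous_on_translate(1)[OF u])
  have c2: "continuous_on UNIV (\<lambda>x. \<xi> a * u x)" by (intro continuous_intros u)
  have "L2_inner \<mu> (\<lambda>x. u (x + a)) (\<lambda>x. \<xi> a * u x) = cnj (\<xi> a) * autocorrelation \<mu> u a"
    by (simp add: L2_inner_def autocorrelation_def add.commute mult.left_commute
        flip: Bochner_Integration.integral_mult_right_zero)
  also have "\<dots> = of_real ((cmod (\<xi> a))\<^sup>2) * autocorrelation \<mu> u 0"
    using ac[of a] by (simp only: complex_norm_square mult_ac)
  also have "\<dots> = of_real ((L2_norm \<mu> u)\<^sup>2)"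
    by (simp add: c1 autocorrelation_zero)
  finally have "(L2_norm \<mu> (\<lambda>x. u (x + a) - \<xi> a * u x))\<^sup>2 = 0"
    unfolding L2_norm_diff_square[OF continuous_L2[OF cu] continuous_L2[OF c2]]
      L2_norm_scale L2_norm_translate[OF u] c1 by simp
  then have "u (x + a) - \<xi> a * u x = 0"
    by (intro L2_norm_eq_0_imp[of "\<lambda>x. u (x + a) - \<xi> a * u x"] continuous_on_diff cu c2) simp
  then show ?thesis by simp
qed

text \<open>
  A Riemann sum: if \<open>z - y\<close> lies in a small neighbourhood of 0, then \<open>g (x - z)\<close> is close to \<open>g (x - y)\<close>, uniformly in \<open>x\<close>. The
  induction over the centres \<open>y\<close> cuts the group into Borel pieces, each close to one of the centres. This
  replaces Fubini's theorem in the computation of Fourier coefficients of convolutions.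
\<close>

lemma convolution_approximation:
  assumes g: "continuous_on UNIV g" and w: "continuous_on UNIV w" and e: "e > 0"
  obtains Y c where "finite Y" "\<And>x. cmod (convolution \<mu> g w x - (\<Sum>y\<in>Y. c y * g (x - y))) \<le> e"
proof -
  define b where "b = (\<integral>y. cmod (w y) \<partial>\<mu>)"
  have b: "b \<ge> 0" by (simp add: b_def)
  (* The total error is d times the L1 norm b of w; the summand 1 covers b = 0. *)
  define d where "d = e / (b + 1)"
  have d: "d > 0" using e b by (simp add: d_def)
  obtain V where V: "open V" "0 \<in> V" "\<And>v x. v \<in> V \<Longrightarrow> cmod (g (x + v) - g x) < d"
    by (rule uniform_continuity[OF g d]) (rule that)
  obtain Y where Y: "finite Y" "\<And>x. \<exists>y\<in>Y. x - y \<in> V"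
    using finite_translate_cover[OF V(1,2)] by blast
  have intw: "integrable \<mu> (\<lambda>z. indicator S z *\<^sub>R w z)" "integrable \<mu> (\<lambda>z. indicator S z *\<^sub>R (g (x - z) * w z))"
    "integrable \<mu> (\<lambda>z. indicator S z *\<^sub>R cmod (w z))"
    if "S \<in> sets borel" for S x
    using that
    by (intro integrable_mult_indicator continuous_integrable continuous_on_mult continuous_on_norm w
      continuous_on_translate(3)[OF g]; simp)+
  have "\<exists>c. \<forall>x. cmod ((\<integral>z. indicator S z *\<^sub>R (g (x - z) * w z) \<partial>\<mu>) - (\<Sum>y\<in>Z. c y * g (x - y)))
      \<le> d * (\<integral>z. indicator S z *\<^sub>R cmod (w z) \<partial>\<mu>)"
    if "finite Z" "S \<in> sets borel" "S \<subseteq> {z. \<exists>y\<in>Z. z - y \<in> V}" for Z S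
    using that
  proof (induction Z arbitrary: S rule: finite_induct)
    case empty
    then show ?case by auto
  next
    case (insert y Z)
    have "open ((\<lambda>z. z - y) -` V)" by (intro open_vimage V continuous_on_translate(4)[OF continuous_on_id])
    then have "(\<lambda>z. z - y) -` V \<in> sets borel" by simp
    define S1 where "S1 = S \<inter> (\<lambda>z. z - y) -` V"
    define S2 where "S2 = S - (\<lambda>z. z - y) -` V"
    have S12: "S1 \<in> sets borel" "S2 \<in> sets borel"
      using insert.prems(1) \<open>(\<lambda>z. z - y) -` V \<in> sets borel\<close> by (auto simp: S1_def S2_def)
    have ind: "indicator S z *\<^sub>R f = indicator S1 z *\<^sub>R f + indicator S2 z *\<^sub>R f"
      "indicator S z *\<^sub>R t = indicator S1 z *\<^sub>R t + indicator S2 z *\<^sub>R t"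
      for z and f :: complex and t :: real
      by (auto simp: S1_def S2_def indicator_def)
    have "S2 \<subseteq> {z. \<exists>y\<in>Z. z - y \<in> V}" using insert.prems(2) by (auto simp: S2_def)
    from insert.IH[OF S12(2) this] obtain c where
      c: "\<And>x. cmod ((\<integral>z. indicator S2 z *\<^sub>R (g (x - z) * w z) \<partial>\<mu>) - (\<Sum>y\<in>Z. c y * g (x - y)))
      \<le> d * (\<integral>z. indicator S2 z *\<^sub>R cmod (w z) \<partial>\<mu>)" by blast
    define c' where "c' = c(y := \<integral>z. indicator S1 z *\<^sub>R w z \<partial>\<mu>)"
    have "cmod ((\<integral>z. indicator S z *\<^sub>R (g (x - z) * w z) \<partial>\<mu>) - (\<Sum>y\<in>insert y Z. c' y * g (x - y)))
      \<le> d * (\<integral>z. indicator S z *\<^sub>R cmod (w z) \<partial>\<mu>)" for x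
    proof -
      have 1: "cmod ((\<integral>z. indicator S1 z *\<^sub>R (g (x - z) * w z) \<partial>\<mu>) - (\<integral>z. indicator S1 z *\<^sub>R w z \<partial>\<mu>) * g (x - y))
        \<le> d * (\<integral>z. indicator S1 z *\<^sub>R cmod (w z) \<partial>\<mu>)"
      proof -
        have "(\<integral>z. indicator S1 z *\<^sub>R (g (x - z) * w z) \<partial>\<mu>) - (\<integral>z. indicator S1 z *\<^sub>R w z \<partial>\<mu>) * g (x - y)
          = (\<integral>z. indicator S1 z *\<^sub>R (g (x - z) * w z) - (indicator S1 z *\<^sub>R w z) * g (x - y) \<partial>\<mu>)"
          by (simp only: Bochner_Integration.integral_diff integral_mult_left_zero
              integrable_mult_left intw[OF S12(1)])
        also have "cmod \<dots> \<le> (\<integral>z. cmod (indicator S1 z *\<^sub>R (g (x - z) * w z) - (indicator S1 z *\<^sub>R w z) * g (x - y)) \<partial>\<mu>)"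
          by (rule integral_norm_bound)
        also have "\<dots> \<le> (\<integral>z. d * (indicator S1 z *\<^sub>R cmod (w z)) \<partial>\<mu>)"
        proof (intro integral_mono Bochner_Integration.integrable_norm Bochner_Integration.integrable_diff
            integrable_mult_left integrable_mult_right intw S12)
          fix z
          show "cmod (indicator S1 z *\<^sub>R (g (x - z) * w z) - (indicator S1 z *\<^sub>R w z) * g (x - y))
            \<le> d * (indicator S1 z *\<^sub>R cmod (w z))"
          proof (cases "z \<in> S1")
            case True
            then have "cmod (g (x - y) - g (x - z)) \<le> d"
              using V(3)[of "z - y" "x - z"] by (simp add: S1_def)
            moreover have "g (x - z) * w z - w z * g (x - y) = (g (x - z) - g (x - y)) * w z"
              by (simp add: algebra_simps)
            ultimately show ?thesis using True
              by (simp add: norm_mult norm_minus_commute mult_right_mono)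
          qed simp
        qed
        finally show ?thesis by simp
      qed
      have sum: "(\<Sum>y\<in>insert y Z. c' y * g (x - y))
        = (\<integral>z. indicator S1 z *\<^sub>R w z \<partial>\<mu>) * g (x - y) + (\<Sum>y\<in>Z. c y * g (x - y))"
        using insert.hyps by (simp add: c'_def) (intro sum.cong, auto)
      have split: "(\<integral>z. indicator S z *\<^sub>R (g (x - z) * w z) \<partial>\<mu>) =
          (\<integral>z. indicator S1 z *\<^sub>R (g (x - z) * w z) \<partial>\<mu>) + (\<integral>z. indicator S2 z *\<^sub>R (g (x - z) * w z) \<partial>\<mu>)"
        "(\<integral>z. indicator S z *\<^sub>R cmod (w z) \<partial>\<mu>) =
          (\<integral>z. indicator S1 z *\<^sub>R cmod (w z) \<partial>\<mu>) + (\<integral>z. indicator S2 z *\<^sub>R cmod (w z) \<partial>\<mu>)"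
        by (simp_all only: ind Bochner_Integration.integral_add intw[OF S12(1)] intw[OF S12(2)])
      have "cmod (a + b - (a' + b')) \<le> d * (t + t')"
        if "cmod (a - a') \<le> d * t" "cmod (b - b') \<le> d * t'" for a b a' b' t t'
        using norm_triangle_ineq[of "a - a'" "b - b'"] that by (simp add: algebra_simps)
      from this[OF 1 c] show ?thesis unfolding sum split .
    qed
    then show ?case by blast
  qed
  from this[OF Y(1), of UNIV] Y(2) obtain c where
    c: "\<And>x. cmod (convolution \<mu> g w x - (\<Sum>y\<in>Y. c y * g (x - y))) \<le> d * b"
    by (auto simp: convolution_def b_def)
  have "d * b \<le> e" using e b by (simp add: d_def field_simps)
  with c Y(1) show ?thesis by (intro that[of Y c]) (auto intro: order_trans)
qed

lemma fourier_translate: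
  assumes f: "continuous_on UNIV f" and \<xi>: "\<xi> \<in> dual_group"
  shows "fourier_transform \<mu> (\<lambda>x. f (x - y)) \<xi> = cnj (\<xi> y) * fourier_transform \<mu> f \<xi>"
proof -
  note c\<xi> = dual_groupD(1)[OF \<xi>]
  have "continuous_on UNIV (\<lambda>x. f (x - y) * cnj (\<xi> x))"
    by (intro continuous_intros continuous_on_translate(4)[OF f] c\<xi>)
  then have "fourier_transform \<mu> (\<lambda>x. f (x - y)) \<xi> = (\<integral>x. cnj (\<xi> y) * (f x * cnj (\<xi> x)) \<partial>\<mu>)"
    unfolding fourier_transform_def using dual_groupD(3)[OF \<xi>]
    by (subst continuous_translation_invariant[OF \<open>continuous_on UNIV (\<lambda>x. f (x - y) * cnj (\<xi> x))\<close>, of y, symmetric])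
      (simp add: mult_ac)
  then show ?thesis by (simp add: fourier_transform_def)
qed

lemma fourier_diff_le:
  assumes "continuous_on UNIV f" "continuous_on UNIV h" "\<xi> \<in> dual_group" "\<And>x. cmod (f x - h x) \<le> e"
  shows "cmod (fourier_transform \<mu> f \<xi> - fourier_transform \<mu> h \<xi>) \<le> e"
proof -
  note c\<xi> = dual_groupD(1)[OF assms(3)]
  have "fourier_transform \<mu> f \<xi> - fourier_transform \<mu> h \<xi> = (\<integral>x. (f x - h x) * cnj (\<xi> x) \<partial>\<mu>)"
    unfolding fourier_transform_def left_diff_distrib
    by (intro Bochner_Integration.integral_diff[symmetric] continuous_integrable continuous_intros assms c\<xi>)
  also have "cmod \<dots> \<le> e"
    using assms(4) dual_groupD(2)[OF assms(3)]
    by (intro integral_norm_le continuous_intros assms c\<xi>) (simp add: norm_mult)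
  finally show ?thesis .
qed

lemma fourier_convolution_eq_0:
  assumes g: "continuous_on UNIV g" and w: "continuous_on UNIV w" and \<xi>: "\<xi> \<in> dual_group"
    and 0: "fourier_transform \<mu> g \<xi> = 0"
  shows "fourier_transform \<mu> (convolution \<mu> g w) \<xi> = 0"
proof -
  have "cmod (fourier_transform \<mu> (convolution \<mu> g w) \<xi>) \<le> 0 + e" if e: "e > 0" for e
  proof -
    obtain Y c where Y: "finite Y" "\<And>x. cmod (convolution \<mu> g w x - (\<Sum>y\<in>Y. c y * g (x - y))) \<le> e"
      using convolution_approximation[OF g w e] by blast
    have "fourier_transform \<mu> (\<lambda>x. \<Sum>y\<in>Y. c y * g (x - y)) \<xi>
       = (\<Sum>y\<in>Y. c y * fourier_transform \<mu> (\<lambda>x. g (x - y)) \<xi>)"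
      unfolding fourier_transform_def sum_distrib_right mult.assoc
      by (subst Bochner_Integration.integral_sum)
        (auto intro!: continuous_integrable continuous_intros continuous_on_translate(4)[OF g] dual_groupD(1)[OF \<xi>])
    also have "\<dots> = 0" by (simp add: fourier_translate[OF g \<xi>] 0)
    finally have "fourier_transform \<mu> (\<lambda>x. \<Sum>y\<in>Y. c y * g (x - y)) \<xi> = 0" .
    moreover have "cmod (fourier_transform \<mu> (convolution \<mu> g w) \<xi> -
        fourier_transform \<mu> (\<lambda>x. \<Sum>y\<in>Y. c y * g (x - y)) \<xi>) \<le> e"
      by (intro fourier_diff_le continuous_convolution g w \<xi> Y continuous_on_sum continuous_on_mult_left
          continuous_on_translate(4)[OF g])
    ultimately show ?thesis by simp
  qed
  then have "cmod (fourier_transform \<mu> (convolution \<mu> g w) \<xi>) \<le> 0"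
    by (rule field_le_epsilon)
  then show ?thesis by simp
qed

lemma fourier_character_self:
  assumes "\<xi> \<in> dual_group" shows "fourier_transform \<mu> \<xi> \<xi> = 1"
proof -
  have "\<xi> x * cnj (\<xi> x) = 1" for x
    using dual_groupD(2)[OF assms] by (simp add: complex_norm_square[symmetric])
  then show ?thesis by (simp add: fourier_transform_def)
qed

text \<open>
  The function \<open>u\<close> that solves the extremal problem is a nonzero multiple of a character \<open>\<xi>\<close>. If \<open>g\<close> were
  orthogonal to \<open>\<xi>\<close>, then so would be all convolutions \<open>g * w\<close> and their uniform limit \<open>u\<close>.
\<close>

theorem exists_nonzero_fourier_coefficient:
  assumes g: "continuous_on UNIV g" and nz: "g y \<noteq> 0"
  shows "\<exists>\<xi>\<in>dual_group. fourier_transform \<mu> g \<xi> \<noteq> 0"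
proof -
  obtain s w u where s: "s > 0"
    and s_bound: "\<And>w. continuous_on UNIV w \<Longrightarrow>
      L2_norm \<mu> (autocorrelation \<mu> (convolution \<mu> g w)) \<le> s * (L2_norm \<mu> w)\<^sup>2"
    and w: "\<And>n. continuous_on UNIV (w n)" "\<And>n::nat. L2_norm \<mu> (w n) \<le> 1"
    and u: "continuous_on UNIV u"
    and lim: "uniform_limit UNIV (\<lambda>n. convolution \<mu> g (w n)) u sequentially"
    and attained: "L2_norm \<mu> (autocorrelation \<mu> u) = s"
    using exists_extremal_convolution[OF g nz] by metis
  define \<psi> where "\<psi> = autocorrelation \<mu> u"
  have c\<psi>: "continuous_on UNIV \<psi>" unfolding \<psi>_def by (rule continuous_autocorrelation[OF u])
  have "\<exists>y. \<psi> y \<noteq> 0"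
  proof (rule ccontr)
    assume "\<nexists>y. \<psi> y \<noteq> 0"
    then have "L2_norm \<mu> \<psi> = 0" by (simp add: L2_norm_def)
    then show False using s attained by (simp add: \<psi>_def)
  qed
  then obtain z where "\<psi> z \<noteq> 0" ..
  define \<xi> where "\<xi> = (\<lambda>a. \<psi> a / \<psi> 0)"
  have eigen: "\<And>a. \<exists>k. \<forall>x. \<psi> (x + a) = k * \<psi> x"
    unfolding \<psi>_def using extremal_eigenfunction[OF g s s_bound w u lim attained] by blast
  have \<psi>0: "\<psi> 0 \<noteq> 0" and \<xi>: "\<xi> \<in> dual_group"
    unfolding \<xi>_def using character_of_translation_eigenfunction[OF c\<psi> \<open>\<psi> z \<noteq> 0\<close> eigen] by auto
  have "u (0 + a) = \<xi> a * u 0" for a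
    by (rule translation_by_autocorrelation_character[OF u \<xi>])
      (use \<psi>0 in \<open>simp add: \<xi>_def flip: \<psi>_def\<close>)
  then have "u = (\<lambda>a. u 0 * \<xi> a)"
    by (intro ext) (metis add_0 mult.commute)
  then obtain k where u_eq: "u = (\<lambda>a. k * \<xi> a)" ..
  have k0: "k \<noteq> 0"
  proof
    assume "k = 0"
    then have "u = (\<lambda>_. 0)" by (simp add: u_eq)
    then show False using \<psi>0 by (simp add: \<psi>_def autocorrelation_def)
  qed
  have "fourier_transform \<mu> u \<xi> = k * fourier_transform \<mu> \<xi> \<xi>"
    unfolding u_eq by (simp add: fourier_transform_def mult.assoc)
  then have ft_u: "fourier_transform \<mu> u \<xi> = k" by (simp add: fourier_character_self \<xi>)
  have "fourier_transform \<mu> g \<xi> \<noteq> 0"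
  proof
    assume 0: "fourier_transform \<mu> g \<xi> = 0"
    have "cmod k > 0" using k0 by simp
    from uniform_limitD[OF lim this] obtain n where n: "\<And>x. dist (convolution \<mu> g (w n) x) (u x) < cmod k"
      by (auto simp: eventually_sequentially)
    (* Attaining the maximum turns the strict pointwise bound into a strict uniform one. *)
    have "\<exists>b<cmod k. \<forall>x. cmod (convolution \<mu> g (w n) x - u x) \<le> b"
    proof -
      have "continuous_on UNIV (\<lambda>x. cmod (convolution \<mu> g (w n) x - u x))"
        by (intro continuous_intros continuous_convolution g w u)
      then obtain x0 where "\<forall>x. cmod (convolution \<mu> g (w n) x - u x) \<le> cmod (convolution \<mu> g (w n) x0 - u x0)"
        using continuous_attains_sup[OF compact_UNIV] by blast
      with n[of x0] show ?thesis unfolding dist_norm by blast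
    qed
    then obtain b where b: "b < cmod k" "\<And>x. cmod (convolution \<mu> g (w n) x - u x) \<le> b" by blast
    have "cmod (fourier_transform \<mu> (convolution \<mu> g (w n)) \<xi> - fourier_transform \<mu> u \<xi>) \<le> b"
      by (intro fourier_diff_le continuous_convolution g w u \<xi> b)
    then show False
      using b(1) by (simp add: fourier_convolution_eq_0[OF g w(1) \<xi> 0] ft_u)
  qed
  with \<xi> show ?thesis by blast
qed

section \<open>Trigonometric polynomials are dense\<close>

lemma Urysohn_group:
  assumes "closed (S :: 'a set)" "closed T" "S \<inter> T = {}"
  obtains f :: "'a \<Rightarrow> real" where "continuous_on UNIV f" "\<And>x. f x \<in> {0..1}"
    "\<And>x. x \<in> S \<Longrightarrow> f x = 1" "\<And>x. x \<in> T \<Longrightarrow> f x = 0"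
proof -
  have "Hausdorff_space (euclidean :: 'a topology)"
    unfolding Hausdorff_space_def disjnt_def using hausdorff by (metis open_openin)
  moreover have "compact_space (euclidean :: 'a topology)"
    using compact_UNIV by (simp add: compact_space_def)
  ultimately have "normal_space (euclidean :: 'a topology)"
    using compact_Hausdorff_or_regular_imp_normal_space by blast
  then obtain f where f: "continuous_map euclidean (top_of_set {0..1::real}) f" "f ` T \<subseteq> {0}" "f ` S \<subseteq> {1}"
    using Urysohn_lemma[of "euclidean :: 'a topology" T S 0 1] assms
    by (auto simp: disjnt_def Int_commute)
  then have "continuous_on UNIV f" "f x \<in> {0..1}" for x
    by (auto simp: continuous_map_in_subtopology Pi_iff)
  with f(2,3) show ?thesis by (intro that[of f]) auto
qed

text \<open>
  If every character were 1 at \<open>a\<close>, then translation by \<open>a\<close> would not change any Fourier coefficient, and \<open>f(\<sqdot> - a) - f\<close>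
  would have none that is nonzero, for a Urysohn function \<open>f\<close> that separates \<open>0\<close> from \<open>a\<close>.
\<close>

lemma characters_separate_points:
  assumes "(a :: 'a) \<noteq> 0"
  shows "\<exists>\<xi>\<in>dual_group. \<xi> a \<noteq> 1"
proof -
  obtain f :: "'a \<Rightarrow> real" where f: "continuous_on UNIV f" "f 0 = 1" "f a = 0"
    using Urysohn_group[of "{0}" "{a}"] assms by auto
  let ?h = "\<lambda>x. complex_of_real (f x)"
  have h: "continuous_on UNIV ?h" by (intro continuous_intros f)
  have h': "continuous_on UNIV (\<lambda>x. ?h (x - a))" by (rule continuous_on_translate(4)[OF h])
  have "\<exists>\<xi>\<in>dual_group. fourier_transform \<mu> (\<lambda>x. ?h (x - a) - ?h x) \<xi> \<noteq> 0"
    by (rule exists_nonzero_fourier_coefficient[of _ a]) (use h h' f in \<open>auto intro!: continuous_on_diff\<close>)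
  then obtain \<xi> where \<xi>: "\<xi> \<in> dual_group" "fourier_transform \<mu> (\<lambda>x. ?h (x - a) - ?h x) \<xi> \<noteq> 0" by blast
  note c\<xi> = dual_groupD(1)[OF \<xi>(1)]
  have "fourier_transform \<mu> (\<lambda>x. ?h (x - a) - ?h x) \<xi>
    = fourier_transform \<mu> (\<lambda>x. ?h (x - a)) \<xi> - fourier_transform \<mu> ?h \<xi>"
    unfolding fourier_transform_def left_diff_distrib
    by (intro Bochner_Integration.integral_diff continuous_integrable continuous_on_mult continuous_on_cnj h h' c\<xi>)
  also have "\<dots> = (cnj (\<xi> a) - 1) * fourier_transform \<mu> ?h \<xi>"
    unfolding fourier_translate[OF h \<xi>(1)] by (simp add: left_diff_distrib)
  finally have "cnj (\<xi> a) \<noteq> 1" using \<xi>(2) by auto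
  then have "\<xi> a \<noteq> 1" by auto
  with \<xi>(1) show ?thesis by blast
qed

text \<open>
  Stone-Weierstrass for the ring of real functions that are trigonometric polynomials as complex functions.
  It contains the real part of every \<open>d \<cdot> \<xi>\<close>; with \<open>d = 1\<close> and \<open>d = - \<i>\<close> these are the real and
  imaginary parts of \<open>\<xi>\<close>, and one of them separates two points that \<open>\<xi>\<close> separates.
\<close>

lemma trigonometric_polynomials_uniformly_dense:
  assumes "continuous_on UNIV (f :: 'a \<Rightarrow> real)" "e > 0"
  shows "\<exists>q\<in>trigonometric_polynomials. \<forall>x. cmod (of_real (f x) - q x) < e"
proof -
  let ?R = "{f :: 'a \<Rightarrow> real. (\<lambda>x. complex_of_real (f x)) \<in> trigonometric_polynomials}"
  have Re_in: "(\<lambda>x. Re (d * \<xi> x)) \<in> ?R" if \<xi>: "\<xi> \<in> dual_group" for \<xi> and d :: complex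
  proof -
    have "(\<lambda>x. (d / 2) * \<xi> x + (cnj d / 2) * cnj (\<xi> x)) \<in> trigonometric_polynomials"
      by (intro trigonometric_polynomials.add trigonometric_polynomials.character dual_group_cnj \<xi>)
    moreover have "(d / 2) * \<xi> x + (cnj d / 2) * cnj (\<xi> x) = complex_of_real (Re (d * \<xi> x))" for x
      by (simp add: complex_eq_iff add_divide_distrib diff_divide_distrib)
    ultimately show ?thesis by simp
  qed
  interpret function_ring_on ?R "UNIV :: 'a set"
  proof
    show "compact (UNIV :: 'a set)" by (rule compact_UNIV)
    show "continuous_on UNIV f" if "f \<in> ?R" for f
      using continuous_on_Re[OF trigonometric_polynomial_continuous[of "\<lambda>x. complex_of_real (f x)"]] that by simp
    show "(\<lambda>x. f x + g x) \<in> ?R" if "f \<in> ?R" "g \<in> ?R" for f g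
      using trigonometric_polynomials.add[of "\<lambda>x. complex_of_real (f x)" "\<lambda>x. complex_of_real (g x)"] that by simp
    show "(\<lambda>x. f x * g x) \<in> ?R" if "f \<in> ?R" "g \<in> ?R" for f g
      using trigonometric_polynomial_mult[of "\<lambda>x. complex_of_real (f x)" "\<lambda>x. complex_of_real (g x)"] that by simp
    show "(\<lambda>_. c) \<in> ?R" for c
      using trigonometric_polynomials.character[OF dual_group_one, of "complex_of_real c"] by simp
    fix x y :: 'a assume "x \<noteq> y"
    then obtain \<xi> where \<xi>: "\<xi> \<in> dual_group" "\<xi> (x - y) \<noteq> 1"
      using characters_separate_points[of "x - y"] by auto
    have "\<xi> x \<noteq> \<xi> y"
    proof
      assume "\<xi> x = \<xi> y"
      then have "\<xi> (x - y) * \<xi> y = 1 * \<xi> y"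
        using dual_groupD(3)[OF \<xi>(1), of "x - y" y] by simp
      then show False using \<xi>(2) dual_groupD(2)[OF \<xi>(1), of y] by auto
    qed
    then have "Re (1 * \<xi> x) \<noteq> Re (1 * \<xi> y) \<or> Re (- \<i> * \<xi> x) \<noteq> Re (- \<i> * \<xi> y)"
      by (simp add: complex_eq_iff)
    then show "\<exists>f\<in>?R. f x \<noteq> f y"
      by (elim disjE) (rule bexI[OF _ Re_in[OF \<xi>(1)]], assumption)+
  qed
  obtain g where g: "g \<in> ?R" "\<forall>x\<in>UNIV. \<bar>f x - g x\<bar> < e"
    using Stone_Weierstrass_basic[OF assms] by meson
  then show ?thesis
    by (intro bexI[of _ "\<lambda>x. complex_of_real (g x)"]) (auto simp flip: of_real_diff)
qed

definition L2_approximable :: "('a \<Rightarrow> complex) \<Rightarrow> bool" where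
  "L2_approximable h \<longleftrightarrow> h \<in> L2 \<mu> \<and> (\<forall>e>0. \<exists>q\<in>trigonometric_polynomials. L2_norm \<mu> (\<lambda>x. h x - q x) < e)"

lemma trigonometric_polynomial_L2: "q \<in> trigonometric_polynomials \<Longrightarrow> q \<in> L2 \<mu>"
  by (intro continuous_L2 trigonometric_polynomial_continuous)

lemma L2_approximable_closed:
  assumes h: "h \<in> L2 \<mu>" and close: "\<And>e. e > 0 \<Longrightarrow> \<exists>k. L2_approximable k \<and> L2_norm \<mu> (\<lambda>x. h x - k x) < e"
  shows "L2_approximable h"
  unfolding L2_approximable_def
proof (intro conjI allI impI h)
  fix e :: real assume "e > 0"
  then obtain k where k: "L2_approximable k" "L2_norm \<mu> (\<lambda>x. h x - k x) < e / 2"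
    using close[of "e / 2"] by auto
  then obtain q where q: "q \<in> trigonometric_polynomials" "L2_norm \<mu> (\<lambda>x. k x - q x) < e / 2"
    using \<open>e > 0\<close> unfolding L2_approximable_def by (meson half_gt_zero)
  have "L2_norm \<mu> (\<lambda>x. h x - q x) \<le> L2_norm \<mu> (\<lambda>x. h x - k x) + L2_norm \<mu> (\<lambda>x. k x - q x)"
    using k(1) unfolding L2_approximable_def
    by (intro L2_norm_triangle_diff h trigonometric_polynomial_L2[OF q(1)]) (erule conjunct1)
  with k q have "L2_norm \<mu> (\<lambda>x. h x - q x) < e" by simp
  with q(1) show "\<exists>q\<in>trigonometric_polynomials. L2_norm \<mu> (\<lambda>x. h x - q x) < e" by blast
qed

lemma L2_approximable_continuous:
  assumes "continuous_on UNIV (f :: 'a \<Rightarrow> real)"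
  shows "L2_approximable (\<lambda>x. of_real (f x))"
  unfolding L2_approximable_def
proof (intro conjI allI impI)
  have c: "continuous_on UNIV (\<lambda>x. complex_of_real (f x))" by (intro continuous_intros assms)
  show "(\<lambda>x. complex_of_real (f x)) \<in> L2 \<mu>" by (rule continuous_L2[OF c])
  fix e :: real assume e: "e > 0"
  then obtain q where q: "q \<in> trigonometric_polynomials" "\<forall>x. cmod (of_real (f x) - q x) < e / 2"
    using trigonometric_polynomials_uniformly_dense[OF assms, of "e / 2"] by auto
  have "L2_norm \<mu> (\<lambda>x. of_real (f x) - q x) \<le> e / 2"
    using q e by (intro L2_norm_le_sup continuous_on_diff c trigonometric_polynomial_continuous)
      (auto intro: less_imp_le)
  with e q(1) show "\<exists>q\<in>trigonometric_polynomials. L2_norm \<mu> (\<lambda>x. of_real (f x) - q x) < e"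
    by (intro bexI[of _ q]) auto
qed

lemma L2_approximable_add:
  assumes "L2_approximable h" "L2_approximable k" shows "L2_approximable (\<lambda>x. h x + k x)"
  unfolding L2_approximable_def
proof (intro conjI allI impI)
  have hk: "h \<in> L2 \<mu>" "k \<in> L2 \<mu>" using assms by (auto simp: L2_approximable_def)
  then show "(\<lambda>x. h x + k x) \<in> L2 \<mu>" by (rule L2_add)
  fix e :: real assume e: "e > 0"
  then obtain p q where p: "p \<in> trigonometric_polynomials" "L2_norm \<mu> (\<lambda>x. h x - p x) < e / 2"
    and q: "q \<in> trigonometric_polynomials" "L2_norm \<mu> (\<lambda>x. k x - q x) < e / 2"
    using assms unfolding L2_approximable_def by (meson half_gt_zero)
  have "L2_norm \<mu> (\<lambda>x. (h x - p x) + (k x - q x)) \<le> L2_norm \<mu> (\<lambda>x. h x - p x) + L2_norm \<mu> (\<lambda>x. k x - q x)"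
    by (intro L2_norm_triangle L2_diff hk trigonometric_polynomial_L2 p q)
  also have "\<dots> < e" using p q by simp
  finally show "\<exists>q\<in>trigonometric_polynomials. L2_norm \<mu> (\<lambda>x. h x + k x - q x) < e"
    by (intro bexI[of _ "\<lambda>x. p x + q x"] trigonometric_polynomials.add p q) (simp add: algebra_simps)
qed

lemma L2_approximable_scale:
  assumes "L2_approximable h" shows "L2_approximable (\<lambda>x. c * h x)"
  unfolding L2_approximable_def
proof (intro conjI allI impI)
  show "(\<lambda>x. c * h x) \<in> L2 \<mu>" using assms by (intro L2_scale) (simp add: L2_approximable_def)
  fix e :: real assume e: "e > 0"
  then have "e / (cmod c + 1) > 0" by (simp add: add_nonneg_pos)
  then obtain q where q: "q \<in> trigonometric_polynomials" "L2_norm \<mu> (\<lambda>x. h x - q x) < e / (cmod c + 1)"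
    using assms unfolding L2_approximable_def by blast
  have "L2_norm \<mu> (\<lambda>x. c * h x - c * q x) = cmod c * L2_norm \<mu> (\<lambda>x. h x - q x)"
    using L2_norm_scale[of \<mu> c "\<lambda>x. h x - q x"] by (simp add: right_diff_distrib)
  also have "\<dots> \<le> cmod c * (e / (cmod c + 1))" using q by (intro mult_left_mono) auto
  also have "\<dots> < e" using e by (simp add: field_simps add_pos_nonneg add_nonneg_pos)
  finally show "\<exists>q\<in>trigonometric_polynomials. L2_norm \<mu> (\<lambda>x. c * h x - q x) < e"
    by (intro bexI[of _ "\<lambda>x. c * q x"] trigonometric_polynomial_scale[OF q(1)])
qed

lemma L2_approximable_sum:
  assumes "finite Y" "\<And>y. y \<in> Y \<Longrightarrow> L2_approximable (h y)"
  shows "L2_approximable (\<lambda>x. \<Sum>y\<in>Y. h y x)"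
  using assms
proof (induction Y rule: finite_induct)
  case empty
  then show ?case using L2_approximable_continuous[of "\<lambda>_. 0"] by simp
qed (auto intro: L2_approximable_add)

lemma L2_indicator:
  assumes "A \<in> sets borel" shows "(\<lambda>x. indicator A x :: complex) \<in> L2 \<mu>"
proof -
  have "(\<lambda>x. (cmod (indicator A x))\<^sup>2) = (indicator A :: 'a \<Rightarrow> real)"
    by (auto simp: indicator_def)
  then show ?thesis using assms unfolding L2_def
    by (auto intro!: integrable_real_indicator simp: less_top[symmetric])
qed

text \<open>
  By regularity \<open>A\<close> lies in an open \<open>U\<close> of nearly the same measure, and \<open>U\<close> contains a compact \<open>K\<close> of nearly the same
  measure. A Urysohn function that is 1 on \<open>K\<close> and 0 outside \<open>U\<close> differs from the indicator of \<open>A\<close> by at most 1, and only on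
  \<open>(U - A) \<union> (U - K)\<close>.
\<close>

lemma L2_approximable_indicator:
  assumes A: "A \<in> sets borel" shows "L2_approximable (indicator A)"
proof (rule L2_approximable_closed[OF L2_indicator[OF A]])
  fix e :: real assume e: "e > 0"
  define d where "d = e\<^sup>2 / 4"
  have d: "d > 0" using e by (simp add: d_def)
  have outer: "emeasure \<mu> A = (INF U\<in>{U. open U \<and> A \<subseteq> U}. emeasure \<mu> U)"
    using haar[unfolded normalized_haar_measure_def, THEN conjunct2, THEN conjunct2, THEN conjunct2, THEN conjunct1] A
    by (rule bspec)
  obtain U where U: "open U" "A \<subseteq> U" "emeasure \<mu> U < emeasure \<mu> A + ennreal d"
    using INF_approx_ennreal[OF d outer] by auto
  have inner: "emeasure \<mu> U = (SUP K\<in>{K. compact K \<and> K \<subseteq> U}. emeasure \<mu> K)"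
    by (rule haar[unfolded normalized_haar_measure_def, THEN conjunct2, THEN conjunct2, THEN conjunct2,
          THEN conjunct2, rule_format, OF U(1)])
  obtain K where K: "compact K" "K \<subseteq> U" "emeasure \<mu> U < emeasure \<mu> K + ennreal d"
    using SUP_approx_ennreal[OF d _ inner] by auto
  have cK: "closed K" using K(1) by (rule compact_imp_closed)
  have sets: "A \<in> sets \<mu>" "U \<in> sets \<mu>" "K \<in> sets \<mu>" using A U cK by auto
  have mU: "measure \<mu> U < t + d" if "emeasure \<mu> U < ennreal t + ennreal d" "t \<ge> 0" for t
    using that d by (simp add: emeasure_eq_measure ennreal_plus[symmetric] ennreal_less_iff del: ennreal_plus)
  have mdiff: "measure \<mu> (U - A) < d" "measure \<mu> (U - K) < d"
    using mU[of "measure \<mu> A"] mU[of "measure \<mu> K"] U(3) K(3)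
    unfolding emeasure_eq_measure
    by (simp_all add: finite_measure_Diff[OF sets(2,1) U(2)] finite_measure_Diff[OF sets(2,3) K(2)])
  have "closed (- U)" using U(1) by (simp add: closed_def)
  obtain f :: "'a \<Rightarrow> real" where f: "continuous_on UNIV f" "\<And>x. f x \<in> {0..1}"
    "\<And>x. x \<in> K \<Longrightarrow> f x = 1" "\<And>x. x \<in> - U \<Longrightarrow> f x = 0"
    by (rule Urysohn_group[OF cK \<open>closed (- U)\<close>]) (use K(2) in blast, rule that)
  have fL2: "(\<lambda>x. complex_of_real (f x)) \<in> L2 \<mu>"
    using L2_approximable_continuous[OF f(1)] by (simp add: L2_approximable_def)
  have "(\<integral>x. (cmod (indicator A x - complex_of_real (f x)))\<^sup>2 \<partial>\<mu>)
      \<le> (\<integral>x. indicat_real (U - A) x + indicat_real (U - K) x \<partial>\<mu>)"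
  proof (rule integral_mono)
    show "integrable \<mu> (\<lambda>x. (cmod (indicator A x - complex_of_real (f x)))\<^sup>2)"
      by (intro L2_integrable L2_diff L2_indicator A fL2)
    show "integrable \<mu> (\<lambda>x. indicat_real (U - A) x + indicat_real (U - K) x)"
      using sets by (auto intro!: integrable_real_indicator simp: less_top[symmetric])
    fix x
    have b: "(cmod (indicator A x - complex_of_real (f x)))\<^sup>2 \<le> 1"
    proof -
      have "indicator A x - complex_of_real (f x) = complex_of_real (indicat_real A x - f x)"
        by (simp add: indicator_def)
      then have "cmod (indicator A x - complex_of_real (f x)) = \<bar>indicat_real A x - f x\<bar>"
        by (simp only: norm_of_real)
      also have "\<dots> \<le> 1" using f(2)[of x] by (auto simp: indicator_def)
      finally show ?thesis by (simp add: power_le_one)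
    qed
    show "(cmod (indicator A x - complex_of_real (f x)))\<^sup>2 \<le> indicat_real (U - A) x + indicat_real (U - K) x"
    proof (cases "x \<in> U")
      case False
      then show ?thesis using f(4)[of x] U(2) by (auto simp: indicator_def)
    next
      case True
      show ?thesis
      proof (cases "x \<in> A \<and> x \<in> K")
        case True
        then show ?thesis using f(3)[of x] by simp
      next
        case False
        then have "1 \<le> indicat_real (U - A) x + indicat_real (U - K) x"
          using \<open>x \<in> U\<close> by (auto simp: indicator_def)
        then show ?thesis using b by linarith
      qed
    qed
  qed
  also have "\<dots> = measure \<mu> (U - A) + measure \<mu> (U - K)"
    using sets by (subst Bochner_Integration.integral_add)
      (auto intro!: integrable_real_indicator simp: less_top[symmetric])
  also have "\<dots> < d + d" using mdiff by simp
  also have "\<dots> \<le> (e\<^sup>2)" using e by (simp add: d_def)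
  finally have "(L2_norm \<mu> (\<lambda>x. indicator A x - complex_of_real (f x)))\<^sup>2 < e\<^sup>2"
    by (simp add: L2_norm_square)
  then have "L2_norm \<mu> (\<lambda>x. indicator A x - complex_of_real (f x)) < e"
    using e by (simp add: power2_less_imp_less)
  with L2_approximable_continuous[OF f(1)]
  show "\<exists>k. L2_approximable k \<and> L2_norm \<mu> (\<lambda>x. indicator A x - k x) < e"
    by (intro exI[of _ "\<lambda>x. complex_of_real (f x)"]) simp
qed

lemma L2_approximable_simple:
  assumes "simple_function \<mu> (s :: 'a \<Rightarrow> complex)" shows "L2_approximable s"
proof -
  have fin: "finite (range s)" using simple_functionD(1)[OF assms] by simp
  have meas: "s -` {y} \<in> sets borel" for y using simple_functionD(2)[OF assms, of "{y}"] by simp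
  have "s x = (\<Sum>y\<in>range s. y * indicator (s -` {y}) x)" for x
  proof -
    have "(\<Sum>y\<in>range s. y * indicator (s -` {y}) x) = (\<Sum>y\<in>range s. if y = s x then y else 0)"
      by (intro sum.cong) (auto simp: indicator_def)
    then show ?thesis using fin by simp
  qed
  then have "s = (\<lambda>x. \<Sum>y\<in>range s. y * indicator (s -` {y}) x)" by (rule ext)
  moreover have "L2_approximable (\<lambda>x. \<Sum>y\<in>range s. y * indicator (s -` {y}) x)"
    by (intro L2_approximable_sum fin L2_approximable_scale L2_approximable_indicator meas)
  ultimately show ?thesis by metis
qed

theorem L2_imp_approximable:
  assumes h: "h \<in> L2 \<mu>" shows "L2_approximable h"
proof (rule L2_approximable_closed[OF h])
  fix e :: real assume e: "e > 0"
  have [measurable]: "h \<in> borel_measurable \<mu>" using h by (rule L2_measurable)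
  from borel_measurable_implies_sequence_metric[OF this, of 0]
  obtain s where s: "\<And>i. simple_function \<mu> (s i)" "\<And>x. (\<lambda>i. s i x) \<longlonglongrightarrow> h x"
    "\<And>i x. cmod (s i x) \<le> 2 * cmod (h x)"
    by auto
  have [measurable]: "s i \<in> borel_measurable \<mu>" for i using s(1) by (rule borel_measurable_simple_function)
  (* The bound |s i| \<le> 2 |h| gives 2 |h|^2 + 2 (2 |h|)^2 = 10 |h|^2 as a dominating function. *)
  have "(\<lambda>i. \<integral>x. (cmod (h x - s i x))\<^sup>2 \<partial>\<mu>) \<longlonglongrightarrow> (\<integral>x. 0 \<partial>\<mu>)"
  proof (rule integral_dominated_convergence[where w = "\<lambda>x. 10 * (cmod (h x))\<^sup>2"])
    show "integrable \<mu> (\<lambda>x. 10 * (cmod (h x))\<^sup>2)" using L2_integrable[OF h] by simp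
    have "(\<lambda>i. (cmod (h x - s i x))\<^sup>2) \<longlonglongrightarrow> (cmod (h x - h x))\<^sup>2" for x by (intro tendsto_intros s)
    then show "AE x in \<mu>. (\<lambda>i. (cmod (h x - s i x))\<^sup>2) \<longlonglongrightarrow> 0" by simp
    have "(cmod (h x - s i x))\<^sup>2 \<le> 10 * (cmod (h x))\<^sup>2" for i x
    proof -
      have "(cmod (s i x))\<^sup>2 \<le> (2 * cmod (h x))\<^sup>2" by (intro power_mono s) simp
      with cmod_diff_square_le[of "h x" "s i x"] show ?thesis by (simp add: power_mult_distrib)
    qed
    then show "AE x in \<mu>. norm ((cmod (h x - s i x))\<^sup>2) \<le> 10 * (cmod (h x))\<^sup>2" for i by simp
  qed measurable
  then have "(\<lambda>i. \<integral>x. (cmod (h x - s i x))\<^sup>2 \<partial>\<mu>) \<longlonglongrightarrow> 0" by simp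
  moreover have "e\<^sup>2 > 0" using e by simp
  ultimately have "\<forall>\<^sub>F i in sequentially. (\<integral>x. (cmod (h x - s i x))\<^sup>2 \<partial>\<mu>) < e\<^sup>2"
    by (rule order_tendstoD)
  then obtain i where "(\<integral>x. (cmod (h x - s i x))\<^sup>2 \<partial>\<mu>) < e\<^sup>2"
    by (auto simp: eventually_sequentially)
  then have "L2_norm \<mu> (\<lambda>x. h x - s i x) < e"
    using e by (simp add: L2_norm_square[symmetric] power2_less_imp_less)
  with L2_approximable_simple[OF s(1)]
  show "\<exists>k. L2_approximable k \<and> L2_norm \<mu> (\<lambda>x. h x - k x) < e" by blast
qed

section \<open>Parseval's identity\<close>

lemma characters_orthogonal:
  assumes \<xi>: "\<xi> \<in> dual_group" and \<eta>: "\<eta> \<in> dual_group" and "\<xi> \<noteq> \<eta>"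
  shows "fourier_transform \<mu> \<xi> \<eta> = 0"
proof -
  obtain a where a: "\<xi> a \<noteq> \<eta> a" using \<open>\<xi> \<noteq> \<eta>\<close> by auto
  have "fourier_transform \<mu> (\<lambda>x. \<xi> (x - a)) \<eta> = cnj (\<eta> a) * fourier_transform \<mu> \<xi> \<eta>"
    by (rule fourier_translate[OF dual_groupD(1)[OF \<xi>] \<eta>])
  moreover have "\<xi> (x - a) = cnj (\<xi> a) * \<xi> x" for x
    using dual_groupD(3)[OF \<xi>, of x "- a"] dual_group_uminus[OF \<xi>] by simp
  then have "fourier_transform \<mu> (\<lambda>x. \<xi> (x - a)) \<eta> = cnj (\<xi> a) * fourier_transform \<mu> \<xi> \<eta>"
    by (simp add: fourier_transform_def mult.assoc)
  ultimately have "(cnj (\<xi> a) - cnj (\<eta> a)) * fourier_transform \<mu> \<xi> \<eta> = 0"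
    by (simp add: left_diff_distrib)
  then show ?thesis using a by auto
qed

lemma fourier_eq_inner: "fourier_transform \<mu> h \<xi> = L2_inner \<mu> h \<xi>"
  by (simp add: fourier_transform_def L2_inner_def)

lemma dual_group_L2: "\<xi> \<in> dual_group \<Longrightarrow> \<xi> \<in> L2 \<mu>"
  by (intro continuous_L2 dual_groupD(1))

text \<open>
  The Pythagorean identity. In particular the Fourier coefficients are the best choice of \<open>c\<close>.
\<close>

lemma L2_distance_to_trigonometric_sum:
  assumes h: "h \<in> L2 \<mu>" and F: "finite F" "F \<subseteq> dual_group"
  shows "(L2_norm \<mu> (\<lambda>x. h x - (\<Sum>\<xi>\<in>F. c \<xi> * \<xi> x)))\<^sup>2 =
    (L2_norm \<mu> h)\<^sup>2 - (\<Sum>\<xi>\<in>F. (cmod (fourier_transform \<mu> h \<xi>))\<^sup>2)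
      + (\<Sum>\<xi>\<in>F. (cmod (fourier_transform \<mu> h \<xi> - c \<xi>))\<^sup>2)"
  using F
proof (induction F rule: finite_induct)
  case empty
  then show ?case by simp
next
  case (insert \<eta> F)
  then have \<eta>: "\<eta> \<in> dual_group" and F: "F \<subseteq> dual_group" "\<eta> \<notin> F" by auto
  define k where "k = (\<lambda>x. h x - (\<Sum>\<xi>\<in>F. c \<xi> * \<xi> x))"
  have sL2: "(\<lambda>x. \<Sum>\<xi>\<in>F. c \<xi> * \<xi> x) \<in> L2 \<mu>"
    using F by (intro L2_sum L2_scale dual_group_L2) auto
  have k: "k \<in> L2 \<mu>" unfolding k_def by (intro L2_diff h sL2)
  have "L2_inner \<mu> h \<eta> = L2_inner \<mu> (\<lambda>x. k x + (\<Sum>\<xi>\<in>F. c \<xi> * \<xi> x)) \<eta>"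
    by (simp add: k_def)
  also have "\<dots> = L2_inner \<mu> k \<eta> + L2_inner \<mu> (\<lambda>x. \<Sum>\<xi>\<in>F. c \<xi> * \<xi> x) \<eta>"
    by (intro L2_inner_add_left k sL2 dual_group_L2 \<eta>)
  also have "L2_inner \<mu> (\<lambda>x. \<Sum>\<xi>\<in>F. c \<xi> * \<xi> x) \<eta> = (\<Sum>\<xi>\<in>F. L2_inner \<mu> (\<lambda>x. c \<xi> * \<xi> x) \<eta>)"
    using F by (intro L2_inner_sum_left L2_scale dual_group_L2 \<eta>) auto
  also have "\<dots> = 0"
  proof (rule sum.neutral, rule ballI)
    fix \<xi> assume "\<xi> \<in> F"
    then have "L2_inner \<mu> \<xi> \<eta> = 0"
      using characters_orthogonal[of \<xi> \<eta>] F \<eta> by (auto simp: fourier_eq_inner)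
    then show "L2_inner \<mu> (\<lambda>x. c \<xi> * \<xi> x) \<eta> = 0" by (simp add: L2_inner_scale_left)
  qed
  finally have inner: "L2_inner \<mu> k \<eta> = fourier_transform \<mu> h \<eta>" by (simp add: fourier_eq_inner)
  have N\<eta>: "L2_norm \<mu> \<eta> = 1" by (simp add: L2_norm_def dual_groupD(2)[OF \<eta>])
  let ?z = "fourier_transform \<mu> h \<eta>"
  have inner_c: "L2_inner \<mu> k (\<lambda>x. c \<eta> * \<eta> x) = cnj (c \<eta>) * ?z"
    using L2_inner_commute[of \<mu> k "\<lambda>x. c \<eta> * \<eta> x"] L2_inner_commute[of \<mu> k \<eta>]
    by (simp add: L2_inner_scale_left inner[symmetric])
  have "(\<lambda>x. h x - (\<Sum>\<xi>\<in>insert \<eta> F. c \<xi> * \<xi> x)) = (\<lambda>x. k x - c \<eta> * \<eta> x)"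
    using insert.hyps by (simp add: k_def algebra_simps)
  then have "(L2_norm \<mu> (\<lambda>x. h x - (\<Sum>\<xi>\<in>insert \<eta> F. c \<xi> * \<xi> x)))\<^sup>2
    = (L2_norm \<mu> k)\<^sup>2 - 2 * Re (cnj (c \<eta>) * ?z) + (cmod (c \<eta>))\<^sup>2"
    by (simp only: L2_norm_diff_square[OF k L2_scale[OF dual_group_L2[OF \<eta>]]] inner_c L2_norm_scale N\<eta> mult_1_right)
  also have "\<dots> = (L2_norm \<mu> k)\<^sup>2 - (cmod ?z)\<^sup>2 + (cmod (?z - c \<eta>))\<^sup>2"
    unfolding cmod_power2 by (simp add: power2_eq_square algebra_simps)
  finally show ?case
    using insert.IH[OF F(1)] insert.hyps by (simp add: k_def)
qed

text \<open>
  Completeness of the characters in the form used below. A finite set of characters, rather than the integral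
  over the dual group, avoids any discussion of the summability of the coefficients of \<open>h\<close>.
\<close>

theorem Parseval_approximation:
  assumes h: "h \<in> L2 \<mu>" and e: "e > 0"
  obtains F where "finite F" "F \<subseteq> dual_group"
    "(L2_norm \<mu> h)\<^sup>2 \<le> e + (\<Sum>\<xi>\<in>F. (cmod (fourier_transform \<mu> h \<xi>))\<^sup>2)"
proof -
  have "sqrt e > 0" using e by simp
  then obtain q where q: "q \<in> trigonometric_polynomials" "L2_norm \<mu> (\<lambda>x. h x - q x) < sqrt e"
    using L2_imp_approximable[OF h] unfolding L2_approximable_def by blast
  obtain F c where F: "finite F" "F \<subseteq> dual_group" "q = (\<lambda>x. \<Sum>\<xi>\<in>F. c \<xi> * \<xi> x)"
    using trigonometric_polynomial_eq_sum[OF q(1)] by blast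
  have "(L2_norm \<mu> (\<lambda>x. h x - q x))\<^sup>2 \<le> (sqrt e)\<^sup>2"
    using q(2) by (intro power_mono) auto
  moreover have "0 \<le> (\<Sum>\<xi>\<in>F. (cmod (fourier_transform \<mu> h \<xi> - c \<xi>))\<^sup>2)"
    by (intro sum_nonneg) auto
  ultimately have "(L2_norm \<mu> h)\<^sup>2 \<le> e + (\<Sum>\<xi>\<in>F. (cmod (fourier_transform \<mu> h \<xi>))\<^sup>2)"
    using L2_distance_to_trigonometric_sum[OF h F(1,2), of c] e unfolding F(3) by simp
  with F(1,2) that show ?thesis by blast
qed

section \<open>The Sobolev embedding\<close>

lemma sobolev_finite_sum_le:
  assumes "h \<in> sobolev_H1 \<mu> \<gamma>" "finite G" "G \<subseteq> dual_group"
  shows "(\<Sum>\<xi>\<in>G. (1 + (\<gamma> \<xi>)\<^sup>2) * (cmod (fourier_transform \<mu> h \<xi>))\<^sup>2) \<le> (sobolev_norm \<mu> \<gamma> h)\<^sup>2"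
proof -
  have i: "integrable (count_space dual_group) (\<lambda>\<xi>. (1 + (\<gamma> \<xi>)\<^sup>2) * (cmod (fourier_transform \<mu> h \<xi>))\<^sup>2)"
    using assms(1) by (simp add: sobolev_H1_def)
  have "(\<Sum>\<xi>\<in>G. (1 + (\<gamma> \<xi>)\<^sup>2) * (cmod (fourier_transform \<mu> h \<xi>))\<^sup>2)
    \<le> (\<integral>\<xi>. (1 + (\<gamma> \<xi>)\<^sup>2) * (cmod (fourier_transform \<mu> h \<xi>))\<^sup>2 \<partial>count_space dual_group)"
    by (rule sum_le_integral_count_space[OF i _ assms(2,3)]) simp
  also have "\<dots> = (sobolev_norm \<mu> \<gamma> h)\<^sup>2"
    unfolding sobolev_norm_def by (subst real_sqrt_pow2) (auto intro!: integral_nonneg_AE)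
  finally show ?thesis .
qed

lemma fourier_character:
  assumes "\<xi> \<in> dual_group" "\<eta> \<in> dual_group"
  shows "fourier_transform \<mu> \<xi> \<eta> = (if \<xi> = \<eta> then 1 else 0)"
  using assms characters_orthogonal fourier_character_self by auto

lemma L2_distance_of_characters:
  assumes "\<xi> \<in> dual_group" "\<eta> \<in> dual_group" "\<xi> \<noteq> \<eta>"
  shows "(L2_norm \<mu> (\<lambda>x. \<xi> x - \<eta> x))\<^sup>2 = 2"
  using L2_norm_diff_square[OF dual_group_L2[OF assms(1)] dual_group_L2[OF assms(2)]]
    characters_orthogonal[OF assms] dual_groupD(2)[OF assms(1)] dual_groupD(2)[OF assms(2)]
  by (simp add: fourier_eq_inner L2_norm_square)

text \<open>
  Characters are orthonormal, hence at mutual distance \<open>sqrt 2\<close>, and the Sobolev norm of \<open>\<xi>\<close> is \<open>sqrt (1 + \<gamma>(\<xi>)\<^sup>2)\<close>. So an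
  infinite sublevel set yields a bounded sequence without convergent subsequence.
\<close>

lemma sobolev_embedding_imp_finite_sublevels:
  assumes "sobolev_compactly_embedded \<mu> \<gamma>"
  shows "finite {\<xi>\<in>dual_group. 1 + (\<gamma> \<xi>)\<^sup>2 \<le> R}"
proof (rule ccontr)
  assume "infinite {\<xi>\<in>dual_group. 1 + (\<gamma> \<xi>)\<^sup>2 \<le> R}"
  then obtain x :: "nat \<Rightarrow> 'a \<Rightarrow> complex" where x: "inj x"
    "range x \<subseteq> {\<xi>\<in>dual_group. 1 + (\<gamma> \<xi>)\<^sup>2 \<le> R}"
    using infinite_countable_subset by blast
  then have xD: "x n \<in> dual_group" "1 + (\<gamma> (x n))\<^sup>2 \<le> R" for n by auto
  let ?f = "\<lambda>n \<eta>. (1 + (\<gamma> \<eta>)\<^sup>2) * (cmod (fourier_transform \<mu> (x n) \<eta>))\<^sup>2"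
  have "x n \<in> sobolev_H1 \<mu> \<gamma>" for n
  proof -
    have "integrable (count_space dual_group) (?f n)"
      by (rule integrable_count_space_finite_support[of "{x n}"]) (auto simp: fourier_character xD)
    then show ?thesis by (simp add: sobolev_H1_def dual_group_L2 xD)
  qed
  moreover have "sobolev_norm \<mu> \<gamma> (x n) \<le> sqrt R" for n
  proof -
    have "(\<integral>\<eta>. ?f n \<eta> \<partial>count_space dual_group) = (\<Sum>\<eta>\<in>{\<eta>\<in>dual_group. ?f n \<eta> \<noteq> 0}. ?f n \<eta>)"
      by (rule lebesgue_integral_count_space_finite_support)
        (rule finite_subset[of _ "{x n}"], auto simp: fourier_character xD split: if_splits)
    also have "\<dots> \<le> (\<Sum>\<eta>\<in>{x n}. ?f n \<eta>)"
      by (rule sum_mono2) (auto simp: fourier_character xD split: if_splits)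
    also have "\<dots> \<le> R" using xD(2)[of n] by (simp add: fourier_character xD)
    finally show ?thesis unfolding sobolev_norm_def by simp
  qed
  ultimately have "L2_convergent_subsequence \<mu> x"
    using assms unfolding sobolev_compactly_embedded_def by blast
  moreover have "\<not> L2_convergent_subsequence \<mu> x"
  proof (rule separated_no_L2_convergent_subsequence)
    show "x n \<in> L2 \<mu>" for n by (rule dual_group_L2[OF xD(1)])
    show "1 > (0 :: real)" by simp
    fix m n :: nat assume "m \<noteq> n"
    then have "x m \<noteq> x n" using x(1) by (auto dest: injD)
    then have "1\<^sup>2 \<le> (L2_norm \<mu> (\<lambda>t. x m t - x n t))\<^sup>2"
      by (subst L2_distance_of_characters) (auto simp: xD)
    then show "1 \<le> L2_norm \<mu> (\<lambda>t. x m t - x n t)" by (rule power2_le_imp_le) simp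
  qed
  ultimately show False by blast
qed

text \<open>
  By Parseval the distance of two members of the sequence is controlled by their coefficients. Outside the finite set
  \<open>F\<close> where \<open>1 + \<gamma>\<^sup>2 \<le> R\<close> the sum of the squared coefficients of one member is at most \<open>B\<^sup>2 / R\<close>, which leaves the coordinates in \<open>F\<close>.
\<close>

lemma finite_sublevels_imp_sobolev_embedding:
  assumes fin: "\<And>R. finite {\<xi>\<in>dual_group. 1 + (\<gamma> \<xi>)\<^sup>2 \<le> R}"
  shows "sobolev_compactly_embedded \<mu> \<gamma>"
proof -
  have conv: "L2_convergent_subsequence \<mu> u"
    if u: "\<And>n. u n \<in> sobolev_H1 \<mu> \<gamma>" and B: "\<And>n. sobolev_norm \<mu> \<gamma> (u n) \<le> B" for u B
  proof (rule L2_convergent_subsequence_of_square_sums[where I = dual_group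
        and c = "\<lambda>n. fourier_transform \<mu> (u n)"])
    have uL2: "u n \<in> L2 \<mu>" for n using u[of n] by (simp add: sobolev_H1_def)
    then show "u n \<in> L2 \<mu>" for n .
    have B0: "B \<ge> 0" using B[of 0] unfolding sobolev_norm_def
      by (rule order_trans[rotated]) (auto intro!: integral_nonneg_AE)
    have sums: "(\<Sum>\<xi>\<in>G. (1 + (\<gamma> \<xi>)\<^sup>2) * (cmod (fourier_transform \<mu> (u n) \<xi>))\<^sup>2) \<le> B\<^sup>2"
      if "finite G" "G \<subseteq> dual_group" for G n
    proof -
      have "(sobolev_norm \<mu> \<gamma> (u n))\<^sup>2 \<le> B\<^sup>2"
        using B[of n] by (intro power_mono) (auto simp: sobolev_norm_def intro!: integral_nonneg_AE)
      with sobolev_finite_sum_le[OF u that, of n] show ?thesis by linarith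
    qed
    show "\<exists>B. \<forall>n. cmod (fourier_transform \<mu> (u n) \<xi>) \<le> B" if "\<xi> \<in> dual_group" for \<xi>
    proof (intro exI[of _ B] allI, rule power2_le_imp_le[OF _ B0])
      fix n
      have "1 * (cmod (fourier_transform \<mu> (u n) \<xi>))\<^sup>2 \<le> (1 + (\<gamma> \<xi>)\<^sup>2) * (cmod (fourier_transform \<mu> (u n) \<xi>))\<^sup>2"
        by (intro mult_right_mono) auto
      also have "\<dots> \<le> B\<^sup>2" using sums[of "{\<xi>}" n] that by simp
      finally show "(cmod (fourier_transform \<mu> (u n) \<xi>))\<^sup>2 \<le> B\<^sup>2" by simp
    qed
    fix e :: real assume e: "e > 0"
    (* The tails will contribute at most 4 B^2 / R \<le> e / 2; adding 1 keeps R positive when B is 0. *)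
    define R where "R = 8 * B\<^sup>2 / e + 1"
    have "8 * B\<^sup>2 / e \<ge> 0" using e by simp
    then have "R > 0" by (simp add: R_def)
    moreover have "8 * B\<^sup>2 \<le> e * R" using e by (simp add: R_def distrib_left)
    ultimately have R: "R > 0" "4 * B\<^sup>2 / R \<le> e / 2" by (simp_all add: divide_le_eq)
    define F where "F = {\<xi>\<in>dual_group. 1 + (\<gamma> \<xi>)\<^sup>2 \<le> R}"
    have F: "finite F" "F \<subseteq> dual_group" using fin by (auto simp: F_def)
    have "(L2_norm \<mu> (\<lambda>x. u m x - u n x))\<^sup>2
        \<le> e + (\<Sum>\<xi>\<in>F. (cmod (fourier_transform \<mu> (u m) \<xi> - fourier_transform \<mu> (u n) \<xi>))\<^sup>2)" for m n
    proof -
      let ?a = "\<lambda>n \<xi>. (cmod (fourier_transform \<mu> (u n) \<xi>))\<^sup>2"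
      let ?d = "\<lambda>\<xi>. (cmod (fourier_transform \<mu> (u m) \<xi> - fourier_transform \<mu> (u n) \<xi>))\<^sup>2"
      have lin: "fourier_transform \<mu> (\<lambda>x. u m x - u n x) \<xi>
        = fourier_transform \<mu> (u m) \<xi> - fourier_transform \<mu> (u n) \<xi>" if "\<xi> \<in> dual_group" for \<xi>
        unfolding fourier_transform_def left_diff_distrib
        by (intro Bochner_Integration.integral_diff L2_inner_integrable uL2 dual_group_L2 that)
      have "e / 2 > 0" using e by simp
      from Parseval_approximation[OF L2_diff[OF uL2[of m] uL2[of n]] this]
      obtain G where G: "finite G" "G \<subseteq> dual_group"
        and "(L2_norm \<mu> (\<lambda>x. u m x - u n x))\<^sup>2
          \<le> e / 2 + (\<Sum>\<xi>\<in>G. (cmod (fourier_transform \<mu> (\<lambda>x. u m x - u n x) \<xi>))\<^sup>2)"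
        by metis
      then have "(L2_norm \<mu> (\<lambda>x. u m x - u n x))\<^sup>2 \<le> e / 2 + (\<Sum>\<xi>\<in>G. ?d \<xi>)"
        using G(2) by (simp add: lin subset_iff)
      also have "(\<Sum>\<xi>\<in>G. ?d \<xi>) \<le> (\<Sum>\<xi>\<in>F \<union> (G - F). ?d \<xi>)"
        using F(1) G(1) by (intro sum_mono2) auto
      also have "\<dots> = (\<Sum>\<xi>\<in>F. ?d \<xi>) + (\<Sum>\<xi>\<in>G - F. ?d \<xi>)"
        using F(1) G(1) by (intro sum.union_disjoint) auto
      also have "(\<Sum>\<xi>\<in>G - F. ?d \<xi>)
        \<le> (\<Sum>\<xi>\<in>G - F. 2 / R * ((1 + (\<gamma> \<xi>)\<^sup>2) * ?a m \<xi> + (1 + (\<gamma> \<xi>)\<^sup>2) * ?a n \<xi>))"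
      proof (rule sum_mono)
        fix \<xi> assume "\<xi> \<in> G - F"
        then have "R \<le> 1 + (\<gamma> \<xi>)\<^sup>2" using G(2) by (auto simp: F_def)
        then have "R * (?a m \<xi> + ?a n \<xi>) \<le> (1 + (\<gamma> \<xi>)\<^sup>2) * (?a m \<xi> + ?a n \<xi>)"
          by (intro mult_right_mono) auto
        then have "2 / R * (R * (?a m \<xi> + ?a n \<xi>)) \<le> 2 / R * ((1 + (\<gamma> \<xi>)\<^sup>2) * (?a m \<xi> + ?a n \<xi>))"
          using R(1) by (intro mult_left_mono) auto
        moreover have "?d \<xi> \<le> 2 / R * (R * (?a m \<xi> + ?a n \<xi>))"
          using cmod_diff_square_le[of "fourier_transform \<mu> (u m) \<xi>" "fourier_transform \<mu> (u n) \<xi>"] R(1)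
          by simp
        ultimately show "?d \<xi> \<le> 2 / R * ((1 + (\<gamma> \<xi>)\<^sup>2) * ?a m \<xi> + (1 + (\<gamma> \<xi>)\<^sup>2) * ?a n \<xi>)"
          by (simp only: distrib_left[of "1 + (\<gamma> \<xi>)\<^sup>2"]) 
      qed
      also have "\<dots> = 2 / R * ((\<Sum>\<xi>\<in>G - F. (1 + (\<gamma> \<xi>)\<^sup>2) * ?a m \<xi>) + (\<Sum>\<xi>\<in>G - F. (1 + (\<gamma> \<xi>)\<^sup>2) * ?a n \<xi>))"
        by (simp only: sum_distrib_left[symmetric] sum.distrib)
      also have "\<dots> \<le> 2 / R * (B\<^sup>2 + B\<^sup>2)"
        using R(1) G by (intro mult_left_mono add_mono sums) auto
      also have "\<dots> \<le> e / 2" using R(2) by simp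
      finally show ?thesis by simp
    qed
    with F show "\<exists>F. finite F \<and> F \<subseteq> dual_group \<and> (\<forall>m n. (L2_norm \<mu> (\<lambda>x. u m x - u n x))\<^sup>2
        \<le> e + (\<Sum>\<xi>\<in>F. (cmod (fourier_transform \<mu> (u m) \<xi> - fourier_transform \<mu> (u n) \<xi>))\<^sup>2))"
      by (intro exI[of _ F]) simp
  qed
  show ?thesis
    unfolding sobolev_compactly_embedded_def
  proof (intro allI impI)
    fix u :: "nat \<Rightarrow> 'a \<Rightarrow> complex" assume u: "(\<forall>n. u n \<in> sobolev_H1 \<mu> \<gamma>) \<and> (\<exists>B. \<forall>n. sobolev_norm \<mu> \<gamma> (u n) \<le> B)"
    obtain B where "\<forall>n. sobolev_norm \<mu> \<gamma> (u n) \<le> B" using u[THEN conjunct2] ..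
    with u show "L2_convergent_subsequence \<mu> u" by (intro conv[of u B]) simp_all
  qed
qed

end

theorem theorem4p1:
  fixes \<mu> :: "'a::{topological_ab_group_add, t2_space} measure"
    and p :: "('a \<Rightarrow> complex) \<Rightarrow> ('a \<Rightarrow> complex) \<Rightarrow> real"
    and \<gamma> :: "('a \<Rightarrow> complex) \<Rightarrow> real"
    and T :: "(('a \<Rightarrow> complex) \<Rightarrow> complex) \<Rightarrow> (('a \<Rightarrow> complex) \<Rightarrow> complex)"
  assumes "compact (UNIV :: 'a set)"
    and "normalized_haar_measure \<mu>"
    and "continuous_invariant_pseudo_metric p"
    and "\<gamma> = (\<lambda>\<xi>. p \<xi> (\<lambda>_. 1))"
    and "T = (\<lambda>f \<xi>. f \<xi> / complex_of_real (sqrt (1 + (\<gamma> \<xi>)\<^sup>2)))"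
  shows "sobolev_compactly_embedded \<mu> \<gamma> \<longleftrightarrow>
         L2_compact_operator (count_space dual_group) T"
proof -
  interpret compact_group_haar \<mu>
    using assms(1,2) by unfold_locales
  have "sobolev_compactly_embedded \<mu> \<gamma> \<longleftrightarrow> (\<forall>R. finite {\<xi>\<in>dual_group. 1 + (\<gamma> \<xi>)\<^sup>2 \<le> R})"
    using sobolev_embedding_imp_finite_sublevels finite_sublevels_imp_sobolev_embedding by metis
  also have "\<dots> \<longleftrightarrow> L2_compact_operator (count_space dual_group) T"
    unfolding assms(5) by (rule diagonal_operator_compact_iff[symmetric])
  finally show ?thesis .
qed

end
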